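(* Let $M_1,M'_1\subset\mathbb C^{N_1}$ be generic real-analytic submanifolds through $0$ of the same dimension. Let $M:=M_1\times\{0\}$ and $M':=M'_1\times\{0\}$, both contained in $\mathbb C^N=\mathbb C^{N_1}\times\mathbb C^{N_2}$, and let $H$ be a $k$-equivalence between $(M,0)$ and $(M',0)$ with $k>1$. Write $Z=(Z^1,Z^2)$ and $H=(H^1,H^2)$ according to this decomposition. Then $H^2(Z^1,0)=O(|Z^1|^k)$, and $Z^1\mapsto H^1(Z^1,0)$ is a $k$-equivalence between $(M_1,0)$ and $(M'_1,0)$.
   Context: A real-analytic submanifold with local defining function $\rho=(\rho^1,\dots,\rho^d)$ is generic if the complex gradients $\rho^j_Z$ are linearly independent at each point. For real-analytic submanifolds $M,M'$ of $\mathbb C^m$ through $0$ of the same dimension and $k>1$, a $k$-equivalence between $(M,0)$ and $(M',0)$ is an invertible formal map $H(Z)=\sum_{|\alpha|\ge1}a_\alpha Z^\alpha$ ($a_\alpha\in\mathbb C^m$, nonzero Jacobian at $0$) with $\rho'(H(Z(x)),\overline{H(Z(x))})=O(|x|^k)$ for some (equivalently any) real-analytic parametrization $x\mapsto Z(x)$ of $M$ near $0=Z(0)$, where $\rho'$ is a local defining function of $M'$. *)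

theory Defs
  imports "HOL-Analysis.Analysis"
begin

section \<open>Real-analytic functions on Euclidean spaces\<close>

text \<open>A real-valued function on a Euclidean space is real-analytic at p if near p it is
  the sum of an (absolutely, i.e. unconditionally) convergent power series in the real
  coordinates (w.r.t. the standard basis) of x - p.  Multi-indices are functions
  Basis -> nat, extended by 0 outside the basis.\<close>

definition real_analytic_at :: "('a::euclidean_space \<Rightarrow> real) \<Rightarrow> 'a \<Rightarrow> bool" where
  "real_analytic_at f p \<longleftrightarrow>
     (\<exists>r>0. \<exists>c :: ('a \<Rightarrow> nat) \<Rightarrow> real. \<forall>x\<in>ball p r.
        ((\<lambda>\<alpha>. c \<alpha> * (\<Prod>b\<in>Basis. ((x - p) \<bullet> b) ^ \<alpha> b)) has_sum f x)
          {\<alpha>. \<forall>b. b \<notin> Basis \<longrightarrow> \<alpha> b = 0})"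

definition real_analytic_on :: "('a::euclidean_space \<Rightarrow> real) \<Rightarrow> 'a set \<Rightarrow> bool" where
  "real_analytic_on f U \<longleftrightarrow> (\<forall>p\<in>U. real_analytic_at f p)"

text \<open>Vector-valued maps: every real coordinate function is real-analytic.\<close>
definition real_analytic_map_on ::
    "('a::euclidean_space \<Rightarrow> 'b::euclidean_space) \<Rightarrow> 'a set \<Rightarrow> bool" where
  "real_analytic_map_on F U \<longleftrightarrow> (\<forall>b\<in>Basis. real_analytic_on (\<lambda>x. F x \<bullet> b) U)"

section \<open>Submanifolds of C^m\<close>

text \<open>Complex gradient  rho_Z = (d rho / d Z_1, ..., d rho / d Z_m) of a real function,
  with d/dZ_l = (d/dx_l - i d/dy_l)/2, Z_l = x_l + i y_l.\<close>
definition cgrad :: "(complex^'m \<Rightarrow> real) \<Rightarrow> complex^'m \<Rightarrow> complex^'m" where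
  "cgrad f Z = (\<chi> l. (complex_of_real (frechet_derivative f (at Z) (axis l 1))
       - \<i> * complex_of_real (frechet_derivative f (at Z) (axis l \<i>))) / 2)"

text \<open>Local defining function of M near 0: real-analytic rho = (rho^1,...,rho^d) on an open
  neighbourhood U of 0 with M \<inter> U = {rho = 0} and d rho^1, ..., d rho^d linearly independent
  (over R) at each point of M \<inter> U.\<close>
definition defining_function_on ::
    "(complex^'m) set \<Rightarrow> (complex^'m \<Rightarrow> real^'d::finite) \<Rightarrow> (complex^'m) set \<Rightarrow> bool" where
  "defining_function_on M \<rho> U \<longleftrightarrow>
     open U \<and> 0 \<in> U \<and> real_analytic_map_on \<rho> U \<and>
     M \<inter> U = {Z\<in>U. \<rho> Z = 0} \<and>
     (\<forall>Z\<in>M \<inter> U. \<forall>c :: 'd \<Rightarrow> real.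
        (\<forall>v. (\<Sum>j\<in>UNIV. c j * frechet_derivative (\<lambda>W. \<rho> W $ j) (at Z) v) = 0)
          \<longrightarrow> (\<forall>j. c j = 0))"

definition local_defining_function :: "(complex^'m) set \<Rightarrow> (complex^'m \<Rightarrow> real^'d::finite) \<Rightarrow> bool" where
  "local_defining_function M \<rho> \<longleftrightarrow> (\<exists>U. defining_function_on M \<rho> U)"

text \<open>Generic real-analytic submanifold of C^m through 0, of real codimension CARD('d)
  (hence of real dimension 2 CARD('m) - CARD('d)).\<close>
definition generic_submanifold :: "'d::finite itself \<Rightarrow> (complex^'m) set \<Rightarrow> bool" where
  "generic_submanifold _ M \<longleftrightarrow> 0 \<in> M \<and>
     (\<exists>(\<rho> :: complex^'m \<Rightarrow> real^'d) U. defining_function_on M \<rho> U \<and>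
        (\<forall>Z\<in>M \<inter> U. \<forall>c :: 'd \<Rightarrow> complex.
           (\<Sum>j\<in>UNIV. c j *s cgrad (\<lambda>W. \<rho> W $ j) Z) = 0 \<longrightarrow> (\<forall>j. c j = 0)))"

text \<open>Real-analytic parametrization of M near 0 = Z(0): a real-analytic immersion of an
  open neighbourhood V of 0 in R^p which is a homeomorphism onto a neighbourhood of 0 in M.\<close>
definition parametrization :: "(complex^'m) set \<Rightarrow> (real^'p \<Rightarrow> complex^'m) \<Rightarrow> bool" where
  "parametrization M Z \<longleftrightarrow> Z 0 = 0 \<and>
     (\<exists>V W. open V \<and> 0 \<in> V \<and> open W \<and> 0 \<in> W \<and> real_analytic_map_on Z V \<and>
        (\<exists>g. homeomorphism V (M \<inter> W) Z g) \<and>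
        (\<forall>x\<in>V. inj (frechet_derivative Z (at x))))"

section \<open>Formal maps and k-equivalences\<close>

text \<open>A formal map H(Z) = sum_alpha a_alpha Z^alpha of C^m is given by its coefficient
  function a :: multi-index => C^m.\<close>
definition monom :: "('m \<Rightarrow> nat) \<Rightarrow> complex^'m \<Rightarrow> complex" where
  "monom \<alpha> Z = (\<Prod>i\<in>UNIV. (Z $ i) ^ \<alpha> i)"

definition unit_mi :: "'m \<Rightarrow> 'm \<Rightarrow> nat" where
  "unit_mi j = (\<lambda>l. if l = j then 1 else 0)"

text \<open>Invertible formal map: no constant term, nonzero Jacobian determinant at 0.\<close>
definition invertible_formal_map :: "(('m::finite \<Rightarrow> nat) \<Rightarrow> complex^'m) \<Rightarrow> bool" where
  "invertible_formal_map a \<longleftrightarrow> a (\<lambda>_. 0) = 0 \<and>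
     det ((\<chi> i j. a (unit_mi j) $ i) :: complex^'m^'m) \<noteq> 0"

text \<open>Truncation of the formal map to terms of total degree < k (a polynomial map).\<close>
definition trunc_map :: "(('m::finite \<Rightarrow> nat) \<Rightarrow> complex^'m) \<Rightarrow> nat \<Rightarrow> complex^'m \<Rightarrow> complex^'m" where
  "trunc_map a k Z = (\<Sum>\<alpha>\<in>{\<alpha>. sum \<alpha> UNIV < k}. monom \<alpha> Z *s a \<alpha>)"

text \<open>f(x) = O(|x|^k) near x = 0.\<close>
definition bigO_pow :: "('a::real_normed_vector \<Rightarrow> 'b::real_normed_vector) \<Rightarrow> nat \<Rightarrow> bool" where
  "bigO_pow f k \<longleftrightarrow> (\<exists>C. \<forall>\<^sub>F x in nhds 0. norm (f x) \<le> C * norm x ^ k)"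

text \<open>k-equivalence between (M,0) and (M',0).  The parameter space of M is R^'p and the
  defining function of M' takes values in R^'e (type arguments).  The condition
  rho'(H(Z(x)), conj H(Z(x))) = O(|x|^k), a statement about the terms of order < k of a formal
  power series in x, only depends on the terms of H of degree < k; it is therefore expressed
  via the polynomial truncation of H, for which the composite is a genuine real-analytic
  function of x.  We use the "for some parametrization / defining function" version.\<close>
definition k_equiv :: "'p::finite itself \<Rightarrow> 'e::finite itself \<Rightarrow> (complex^'m) set \<Rightarrow> (complex^'m) set \<Rightarrow>
    (('m::finite \<Rightarrow> nat) \<Rightarrow> complex^'m) \<Rightarrow> nat \<Rightarrow> bool" where
  "k_equiv _ _ M M' a k \<longleftrightarrow> invertible_formal_map a \<and>
     (\<exists>(Z :: real^'p \<Rightarrow> complex^'m) (\<rho>' :: complex^'m \<Rightarrow> real^'e).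
        parametrization M Z \<and> local_defining_function M' \<rho>' \<and>
        bigO_pow (\<lambda>x. \<rho>' (trunc_map a k (Z x))) k)"

section \<open>Product decomposition C^N = C^N1 x C^N2\<close>

definition emb :: "complex^'a::finite \<Rightarrow> complex^('a + 'b::finite)" where
  "emb z = (\<chi> s. case s of Inl i \<Rightarrow> z $ i | Inr _ \<Rightarrow> 0)"

text \<open>Multi-index in Z^1 only (exponent 0 in Z^2).\<close>
definition ext_mi :: "('a \<Rightarrow> nat) \<Rightarrow> ('a + 'b) \<Rightarrow> nat" where
  "ext_mi \<beta> = (\<lambda>s. case s of Inl i \<Rightarrow> \<beta> i | Inr _ \<Rightarrow> 0)"

end

theory Submission
  imports Defs "HOL-Complex_Analysis.Conformal_Mappings"
begin

text \<open>Let \<open>Z = (Z\<^sup>1, 0)\<close> parametrize \<open>M\<close>, so that \<open>Z\<^sup>1\<close> parametrizes \<open>M\<^sub>1\<close>, and let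
  \<open>w(x) = H(Z(x))\<close>.  A local defining function \<open>\<rho>'\<close> of \<open>M'\<close> is a submersion at \<open>0\<close>, so by
  the Lyusternik--Graves theorem the distance from \<open>w(x)\<close> to \<open>M' = M'\<^sub>1 \<times> {0}\<close> is
  \<open>O(|\<rho>'(w(x))|) = O(|x|\<^sup>k)\<close>.  Hence \<open>H\<^sup>2(Z\<^sup>1(x), 0) = O(|x|\<^sup>k)\<close>, and since any defining
  function of \<open>M'\<^sub>1\<close> is Lipschitz, it is \<open>O(|x|\<^sup>k)\<close> along \<open>H\<^sup>1(Z\<^sup>1(x), 0)\<close>.

  To pass from \<open>H\<^sup>2(Z\<^sup>1(x), 0) = O(|x|\<^sup>k)\<close> to the vanishing of the coefficients of
  \<open>H\<^sup>2(\<cdot>, 0)\<close> of degree \<open>< k\<close>: the tangent space \<open>T\<close> of the generic submanifold \<open>M\<^sub>1\<close>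
  satisfies \<open>T + iT = \<complex>\<^sup>N\<^sup>1\<close>.  Along rays \<open>t x\<close>, the lowest homogeneous part of the
  polynomial must vanish on \<open>T\<close>, hence on \<open>T + iT\<close> by analytic continuation in one complex
  variable, hence identically.  In particular the \<open>Z\<^sup>1\<close>-derivatives of \<open>H\<^sup>2\<close> vanish at \<open>0\<close>,
  the Jacobian of \<open>H\<close> is block triangular, and \<open>H\<^sup>1(\<cdot>, 0)\<close> is invertible.\<close>

section \<open>Strict differentiability of real-analytic maps\<close>

definition basis_monomial :: "('a::euclidean_space \<Rightarrow> nat) \<Rightarrow> 'a \<Rightarrow> real" where
  "basis_monomial \<alpha> y = (\<Prod>b\<in>Basis. (y \<bullet> b) ^ \<alpha> b)"

definition basis_degree :: "('a::euclidean_space \<Rightarrow> nat) \<Rightarrow> nat" where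
  "basis_degree \<alpha> = (\<Sum>b\<in>Basis. \<alpha> b)"

definition basis_multi_indices :: "('a::euclidean_space \<Rightarrow> nat) set" where
  "basis_multi_indices = {\<alpha>. \<forall>b. b \<notin> Basis \<longrightarrow> \<alpha> b = 0}"

lemma basis_monomial_unit_mi:
  assumes "b \<in> Basis"
  shows "basis_monomial (unit_mi b) y = y \<bullet> b"
proof -
  have "basis_monomial (unit_mi b) y = (\<Prod>b'\<in>Basis. if b' = b then y \<bullet> b' else 1)"
    unfolding basis_monomial_def by (intro prod.cong) (auto simp: unit_mi_def)
  also have "\<dots> = y \<bullet> b" using assms by (subst prod.delta) auto
  finally show ?thesis .
qed

lemma basis_monomial_degree_0:
  assumes "basis_degree \<alpha> = 0"
  shows "basis_monomial \<alpha> y = 1"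
  using assms by (simp add: basis_degree_def basis_monomial_def)

lemma basis_degree_eq_1:
  assumes "\<alpha> \<in> basis_multi_indices" "basis_degree \<alpha> = 1"
  obtains b where "b \<in> Basis" "\<alpha> = unit_mi b"
proof -
  obtain b where b: "b \<in> Basis" "\<alpha> b = 1" "\<forall>b'\<in>Basis. b \<noteq> b' \<longrightarrow> \<alpha> b' = 0"
    using assms(2) sum_eq_Suc0_iff[of "Basis::'a set" \<alpha>] by (auto simp: basis_degree_def)
  have "\<alpha> = unit_mi b"
    using assms(1) b by (auto simp: fun_eq_iff unit_mi_def basis_multi_indices_def)
  with b show thesis using that by blast
qed

lemma basis_monomial_diff_le:
  fixes y y' :: "'a::euclidean_space" and t :: real
  assumes "norm y \<le> t" "norm y' \<le> t" "0 < t"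
  shows "\<bar>basis_monomial \<alpha> y - basis_monomial \<alpha> y'\<bar>
           \<le> basis_degree \<alpha> * t ^ (basis_degree \<alpha> - 1) * norm (y - y')"
proof (cases "basis_degree \<alpha> = 0")
  case True
  then show ?thesis by (simp add: basis_monomial_degree_0)
next
  case False
  define z where "z b = ((y \<bullet> b) / t) ^ \<alpha> b" for b
  define w where "w b = ((y' \<bullet> b) / t) ^ \<alpha> b" for b
  have scale: "basis_monomial \<alpha> x = t ^ basis_degree \<alpha> * (\<Prod>b\<in>Basis. ((x \<bullet> b) / t) ^ \<alpha> b)" for x :: 'a
    unfolding basis_monomial_def basis_degree_def power_sum prod.distrib[symmetric]
    using \<open>0 < t\<close> by (intro prod.cong) (auto simp: power_mult_distrib[symmetric])
  have coord_le: "\<bar>(y \<bullet> b) / t\<bar> \<le> 1" "\<bar>(y' \<bullet> b) / t\<bar> \<le> 1" if "b \<in> Basis" for b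
    using Basis_le_norm[OF that, of y] Basis_le_norm[OF that, of y'] assms by auto
  have "norm (prod z Basis - prod w Basis) \<le> (\<Sum>b\<in>Basis. norm (z b - w b))"
    using coord_le by (intro norm_prod_diff) (auto simp: z_def w_def power_le_one power_abs)
  also have "\<dots> \<le> (\<Sum>b\<in>Basis. \<alpha> b * (norm (y - y') / t))"
  proof (rule sum_mono)
    fix b :: 'a assume b: "b \<in> Basis"
    have "norm (z b - w b) \<le> \<alpha> b * norm ((y \<bullet> b) / t - (y' \<bullet> b) / t)"
      unfolding z_def w_def using coord_le[OF b] by (intro norm_power_diff) auto
    also have "norm ((y \<bullet> b) / t - (y' \<bullet> b) / t) = \<bar>(y - y') \<bullet> b\<bar> / t"
      using \<open>0 < t\<close> by (simp add: inner_diff_left diff_divide_distrib[symmetric])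
    also have "\<dots> \<le> norm (y - y') / t"
      using Basis_le_norm[OF b] \<open>0 < t\<close> by (simp add: divide_right_mono)
    finally show "norm (z b - w b) \<le> \<alpha> b * (norm (y - y') / t)"
      by (simp add: mult_left_mono order_trans)
  qed
  also have "\<dots> = basis_degree \<alpha> * (norm (y - y') / t)"
    unfolding basis_degree_def by (simp add: sum_distrib_right sum_divide_distrib)
  finally have *: "\<bar>prod z Basis - prod w Basis\<bar> \<le> basis_degree \<alpha> * (norm (y - y') / t)"
    by simp
  have "\<bar>basis_monomial \<alpha> y - basis_monomial \<alpha> y'\<bar> = t ^ basis_degree \<alpha> * \<bar>prod z Basis - prod w Basis\<bar>"
    unfolding scale z_def w_def using \<open>0 < t\<close> by (simp add: right_diff_distrib[symmetric] abs_mult)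
  also have "\<dots> \<le> t ^ basis_degree \<alpha> * (basis_degree \<alpha> * (norm (y - y') / t))"
    using * \<open>0 < t\<close> by (intro mult_left_mono) auto
  also have "\<dots> = basis_degree \<alpha> * t ^ (basis_degree \<alpha> - 1) * norm (y - y')"
    using False \<open>0 < t\<close> by (cases "basis_degree \<alpha>") (simp_all add: field_simps)
  finally show ?thesis .
qed

lemma power_pred_mult_le:
  fixes s t :: real
  assumes "0 < t" "t \<le> s / 2" "2 \<le> n"
  shows "n * t ^ (n - 1) \<le> 4 / s\<^sup>2 * s ^ n * t"
proof -
  obtain m where n: "n = m + 2" using assms(3) by (metis add.commute le_Suc_ex)
  have "real (m + 2) \<le> 2 ^ (m + 2)"
    by (metis less_exp less_imp_le of_nat_le_iff of_nat_numeral of_nat_power)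
  then have m2: "real (m + 2) \<le> 4 * 2 ^ m" by simp
  have "t ^ m \<le> (s / 2) ^ m" using assms by (intro power_mono) auto
  then have tm: "t ^ m \<le> s ^ m / 2 ^ m" by (simp add: power_divide)
  have "n * t ^ (n - 1) = real (m + 2) * t ^ m * t" unfolding n by simp
  also have "\<dots> \<le> (4 * 2 ^ m) * (s ^ m / 2 ^ m) * t"
    using tm m2 assms by (intro mult_right_mono mult_mono) auto
  also have "\<dots> = 4 / s\<^sup>2 * s ^ n * t"
    using assms unfolding n by (simp add: field_simps power_add power2_eq_square)
  finally show ?thesis .
qed

lemma basis_monomial_diff_le_nonlinear:
  fixes y y' :: "'a::euclidean_space"
  assumes "\<alpha> \<in> basis_multi_indices" "\<alpha> \<notin> unit_mi ` Basis"
    and "0 < t" "t \<le> s / 2" "norm y \<le> t" "norm y' \<le> t"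
  shows "\<bar>basis_monomial \<alpha> y - basis_monomial \<alpha> y'\<bar>
           \<le> 4 / s\<^sup>2 * s ^ basis_degree \<alpha> * t * norm (y - y')"
proof -
  consider "basis_degree \<alpha> = 0" | "basis_degree \<alpha> = 1" | "2 \<le> basis_degree \<alpha>" by linarith
  then show ?thesis
  proof cases
    case 1
    then show ?thesis using assms(3,4) by (simp add: basis_monomial_degree_0)
  next
    case 2
    with assms(1,2) show ?thesis by (metis basis_degree_eq_1 image_eqI)
  next
    case 3
    have "\<bar>basis_monomial \<alpha> y - basis_monomial \<alpha> y'\<bar>
        \<le> basis_degree \<alpha> * t ^ (basis_degree \<alpha> - 1) * norm (y - y')"
      using assms by (intro basis_monomial_diff_le) auto
    also have "\<dots> \<le> 4 / s\<^sup>2 * s ^ basis_degree \<alpha> * t * norm (y - y')"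
      using assms 3 by (intro mult_right_mono power_pred_mult_le) auto
    finally show ?thesis .
  qed
qed

text \<open>Convergence at the point whose coordinates relative to \<open>p\<close> all equal \<open>s\<close> gives
  unconditional, hence absolute, convergence of \<open>\<Sum> c \<alpha> s\<^bsup>|\<alpha>|\<^esup>\<close>.\<close>

lemma real_analytic_at_abs_summable:
  assumes "real_analytic_at f p"
  obtains c s where "0 < s"
    and "(\<lambda>\<alpha>. \<bar>c \<alpha>\<bar> * s ^ basis_degree \<alpha>) summable_on basis_multi_indices"
    and "\<And>x. norm (x - p) \<le> s \<Longrightarrow>
           ((\<lambda>\<alpha>. c \<alpha> * basis_monomial \<alpha> (x - p)) has_sum f x) basis_multi_indices"
proof -
  obtain r c where r: "r > 0" and hs: "\<And>x. x \<in> ball p r \<Longrightarrow>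
      ((\<lambda>\<alpha>. c \<alpha> * basis_monomial \<alpha> (x - p)) has_sum f x) basis_multi_indices"
    using assms unfolding real_analytic_at_def basis_monomial_def basis_multi_indices_def by blast
  define s where "s = r / (2 * DIM('a))"
  have "real DIM('a) \<ge> 1" using DIM_positive[where 'a='a] by linarith
  then have "s \<le> r / 2" unfolding s_def using r by (intro divide_left_mono) auto
  then have s: "0 < s" "s < r" using r by (auto simp: s_def)
  define x0 where "x0 = p + s *\<^sub>R (\<Sum>b\<in>Basis. b)"
  have "norm (x0 - p) = s * norm (\<Sum>b\<in>(Basis::'a set). b)" using s by (simp add: x0_def)
  also have "\<dots> \<le> s * (\<Sum>b\<in>(Basis::'a set). norm b)" using s by (intro mult_left_mono norm_sum) auto
  also have "\<dots> < r" using r by (simp add: s_def)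
  finally have "x0 \<in> ball p r" by (simp add: dist_norm norm_minus_commute)
  moreover have "basis_monomial \<alpha> (x0 - p) = s ^ basis_degree \<alpha>" for \<alpha>
    by (simp add: x0_def basis_monomial_def basis_degree_def inner_sum_left inner_Basis
        sum.delta power_sum)
  ultimately have "((\<lambda>\<alpha>. c \<alpha> * s ^ basis_degree \<alpha>) has_sum f x0) basis_multi_indices"
    using hs by fastforce
  then have "(\<lambda>\<alpha>. c \<alpha> * s ^ basis_degree \<alpha>) summable_on basis_multi_indices"
    by (auto simp: summable_on_def)
  then have "(\<lambda>\<alpha>. norm (c \<alpha> * s ^ basis_degree \<alpha>)) summable_on basis_multi_indices"
    by (rule summable_on_iff_abs_summable_on_real[THEN iffD1])
  then have "(\<lambda>\<alpha>. \<bar>c \<alpha>\<bar> * s ^ basis_degree \<alpha>) summable_on basis_multi_indices"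
    using s by (simp add: abs_mult)
  then show thesis using that s hs by (auto simp: dist_norm norm_minus_commute)
qed

definition strict_derivative_at ::
    "('a::euclidean_space \<Rightarrow> 'b::real_normed_vector) \<Rightarrow> ('a \<Rightarrow> 'b) \<Rightarrow> 'a \<Rightarrow> bool" where
  "strict_derivative_at F L p \<longleftrightarrow> linear L \<and> (\<exists>K \<delta>. 0 < \<delta> \<and> 0 \<le> K \<and>
     (\<forall>t u v. 0 < t \<longrightarrow> t \<le> \<delta> \<longrightarrow> norm (u - p) \<le> t \<longrightarrow> norm (v - p) \<le> t \<longrightarrow>
        norm (F u - F v - L (u - v)) \<le> K * t * norm (u - v)))"

lemma power_series_increment_le:
  fixes c :: "('a::euclidean_space \<Rightarrow> nat) \<Rightarrow> real"
  assumes abs_sum: "(\<lambda>\<alpha>. \<bar>c \<alpha>\<bar> * s ^ basis_degree \<alpha>) summable_on basis_multi_indices"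
    and expansion: "\<And>x. norm (x - p) \<le> s \<Longrightarrow>
           ((\<lambda>\<alpha>. c \<alpha> * basis_monomial \<alpha> (x - p)) has_sum f x) basis_multi_indices"
    and t: "0 < t" "t \<le> s / 2" and uv: "norm (u - p) \<le> t" "norm (v - p) \<le> t"
  shows "\<bar>f u - f v - (\<Sum>b\<in>Basis. c (unit_mi b) * ((u - v) \<bullet> b))\<bar>
    \<le> 4 / s\<^sup>2 * infsum (\<lambda>\<alpha>. \<bar>c \<alpha>\<bar> * s ^ basis_degree \<alpha>) (basis_multi_indices - unit_mi ` Basis)
        * t * norm (u - v)" (is "\<bar>f u - f v - ?L\<bar> \<le> ?K * t * norm (u - v)")
proof -
  define higher where "higher = basis_multi_indices - unit_mi ` (Basis::'a set)"
  define G where "G \<alpha> = c \<alpha> * (basis_monomial \<alpha> (u - p) - basis_monomial \<alpha> (v - p))" for \<alpha>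
  have "((\<lambda>\<alpha>. c \<alpha> * basis_monomial \<alpha> (u - p) + - (c \<alpha> * basis_monomial \<alpha> (v - p)))
      has_sum (f u + - f v)) basis_multi_indices"
    using t uv by (intro has_sum_add has_sum_uminusI expansion) auto
  moreover have "G = (\<lambda>\<alpha>. c \<alpha> * basis_monomial \<alpha> (u - p) + - (c \<alpha> * basis_monomial \<alpha> (v - p)))"
    by (simp add: fun_eq_iff G_def algebra_simps)
  ultimately have "(G has_sum (f u - f v)) basis_multi_indices" by simp
  moreover have "(G has_sum ?L) (unit_mi ` Basis)"
  proof -
    have "inj_on unit_mi (Basis::'a set)"
      unfolding inj_on_def unit_mi_def fun_eq_iff by (metis zero_neq_one)
    then have "sum G (unit_mi ` Basis) = ?L"
      by (simp add: sum.reindex G_def basis_monomial_unit_mi inner_diff_left)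
    then show ?thesis by (metis finite_Basis finite_imageI has_sum_finite)
  qed
  ultimately have G_higher: "(G has_sum (f u - f v - ?L)) higher"
    unfolding higher_def
    by (rule has_sum_Diff) (auto simp: basis_multi_indices_def unit_mi_def)
  define B where "B = 4 / s\<^sup>2 * t * norm (u - v)"
  have G_le: "\<bar>G \<alpha>\<bar> \<le> B * (\<bar>c \<alpha>\<bar> * s ^ basis_degree \<alpha>)" if "\<alpha> \<in> higher" for \<alpha>
  proof -
    have "\<bar>G \<alpha>\<bar> \<le> \<bar>c \<alpha>\<bar> * (4 / s\<^sup>2 * s ^ basis_degree \<alpha> * t * norm ((u - p) - (v - p)))"
      unfolding G_def abs_mult using that t uv
      by (intro mult_left_mono basis_monomial_diff_le_nonlinear) (auto simp: higher_def)
    then show ?thesis by (simp add: B_def algebra_simps)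
  qed
  have "(\<lambda>\<alpha>. \<bar>c \<alpha>\<bar> * s ^ basis_degree \<alpha>) summable_on higher"
    using abs_sum by (rule summable_on_subset_banach) (auto simp: higher_def)
  from has_sum_cmult_right[OF has_sum_infsum[OF this], of B]
  have bound_sum: "((\<lambda>\<alpha>. B * (\<bar>c \<alpha>\<bar> * s ^ basis_degree \<alpha>)) has_sum ?K * t * norm (u - v)) higher"
    by (simp add: B_def higher_def algebra_simps)
  have "f u - f v - ?L \<le> ?K * t * norm (u - v)"
    by (rule has_sum_mono[OF G_higher bound_sum]) (use G_le in force)
  moreover have "- (f u - f v - ?L) \<le> ?K * t * norm (u - v)"
    by (rule has_sum_mono[OF has_sum_uminusI[OF G_higher] bound_sum]) (use G_le in force)
  ultimately show ?thesis by linarith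
qed

lemma real_analytic_at_strict_derivative:
  assumes "real_analytic_at f p"
  shows "\<exists>L. strict_derivative_at f L p"
proof -
  obtain c s where "0 < s"
    and abs_sum: "(\<lambda>\<alpha>. \<bar>c \<alpha>\<bar> * s ^ basis_degree \<alpha>) summable_on basis_multi_indices"
    and expansion: "\<And>x. norm (x - p) \<le> s \<Longrightarrow>
           ((\<lambda>\<alpha>. c \<alpha> * basis_monomial \<alpha> (x - p)) has_sum f x) basis_multi_indices"
    using real_analytic_at_abs_summable[OF assms] by blast
  define L where "L y = (\<Sum>b\<in>Basis. c (unit_mi b) * (y \<bullet> b))" for y
  define K where "K = 4 / s\<^sup>2 *
    infsum (\<lambda>\<alpha>. \<bar>c \<alpha>\<bar> * s ^ basis_degree \<alpha>) (basis_multi_indices - unit_mi ` (Basis::'a set))"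
  have "linear L"
    by (rule linearI) (simp_all add: L_def inner_add_left algebra_simps sum.distrib sum_distrib_left)
  moreover have "0 \<le> K"
    unfolding K_def using \<open>0 < s\<close> by (intro mult_nonneg_nonneg infsum_nonneg) auto
  moreover have "\<bar>f u - f v - L (u - v)\<bar> \<le> K * t * norm (u - v)"
    if "0 < t" "t \<le> s / 2" "norm (u - p) \<le> t" "norm (v - p) \<le> t" for t u v
    unfolding L_def K_def by (rule power_series_increment_le[OF abs_sum expansion that])
  ultimately have "strict_derivative_at f L p"
    unfolding strict_derivative_at_def using \<open>0 < s\<close>
    by (intro conjI exI[of _ K] exI[of _ "s / 2"]) auto
  then show ?thesis by blast
qed

lemma strict_derivative_at_euclidean:
  fixes F :: "'a::euclidean_space \<Rightarrow> 'b::euclidean_space"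
  assumes "\<And>b. b \<in> Basis \<Longrightarrow> strict_derivative_at (\<lambda>x. F x \<bullet> b) (L' b) p"
  shows "strict_derivative_at F (\<lambda>x. \<Sum>b\<in>Basis. L' b x *\<^sub>R b) p"
proof -
  have "\<forall>b\<in>Basis. \<exists>K \<delta>. 0 < \<delta> \<and> 0 \<le> K \<and> (\<forall>t u v. 0 < t \<longrightarrow> t \<le> \<delta> \<longrightarrow> norm (u - p) \<le> t \<longrightarrow>
      norm (v - p) \<le> t \<longrightarrow> \<bar>F u \<bullet> b - F v \<bullet> b - L' b (u - v)\<bar> \<le> K * t * norm (u - v))"
    using assms by (auto simp: strict_derivative_at_def)
  then obtain K \<delta> where K\<delta>: "\<And>b. b \<in> Basis \<Longrightarrow> 0 < \<delta> b \<and> 0 \<le> K b \<and>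
      (\<forall>t u v. 0 < t \<longrightarrow> t \<le> \<delta> b \<longrightarrow> norm (u - p) \<le> t \<longrightarrow> norm (v - p) \<le> t \<longrightarrow>
        \<bar>F u \<bullet> b - F v \<bullet> b - L' b (u - v)\<bar> \<le> K b * t * norm (u - v))"
    by metis
  define L where "L x = (\<Sum>b\<in>Basis. L' b x *\<^sub>R b)" for x
  have "linear L"
    unfolding L_def linear_conv_bounded_linear
    using assms by (intro bounded_linear_sum bounded_linear_scaleR_const)
      (auto simp: strict_derivative_at_def linear_conv_bounded_linear)
  moreover have "0 < Min (\<delta> ` Basis)" using K\<delta> by (subst Min_gr_iff) auto
  moreover have "0 \<le> sum K Basis" using K\<delta> by (intro sum_nonneg) auto
  moreover have "norm (F u - F v - L (u - v)) \<le> sum K Basis * t * norm (u - v)"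
    if t: "0 < t" "t \<le> Min (\<delta> ` Basis)" and uv: "norm (u - p) \<le> t" "norm (v - p) \<le> t" for t u v
  proof -
    have "F u - F v - L (u - v) = (\<Sum>b\<in>Basis. (F u \<bullet> b - F v \<bullet> b - L' b (u - v)) *\<^sub>R b)"
      by (simp add: L_def scaleR_diff_left sum_subtractf euclidean_representation)
    also have "norm \<dots> \<le> (\<Sum>b\<in>Basis. K b * t * norm (u - v))"
    proof (intro norm_sum[THEN order_trans] sum_mono)
      fix b :: 'b assume b: "b \<in> Basis"
      have "t \<le> \<delta> b" using t b by (meson Min_le finite_Basis finite_imageI imageI order_trans)
      then show "norm ((F u \<bullet> b - F v \<bullet> b - L' b (u - v)) *\<^sub>R b) \<le> K b * t * norm (u - v)"
        using K\<delta>[OF b] t uv b by auto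
    qed
    finally show ?thesis by (simp add: sum_distrib_right)
  qed
  ultimately show ?thesis
    unfolding strict_derivative_at_def L_def by blast
qed

lemma real_analytic_map_on_strict_derivative:
  assumes "real_analytic_map_on F U" "p \<in> U"
  shows "\<exists>L. strict_derivative_at F L p"
proof -
  have "\<forall>b\<in>Basis. \<exists>L. strict_derivative_at (\<lambda>x. F x \<bullet> b) L p"
    using assms by (auto simp: real_analytic_map_on_def real_analytic_on_def
        intro: real_analytic_at_strict_derivative)
  then obtain L' where "\<And>b. b \<in> Basis \<Longrightarrow> strict_derivative_at (\<lambda>x. F x \<bullet> b) (L' b) p"
    by metis
  then show ?thesis using strict_derivative_at_euclidean by blast
qed

lemma strict_derivative_at_imp_has_derivative:
  assumes "strict_derivative_at F L p"
  shows "(F has_derivative L) (at p)"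
proof -
  obtain K \<delta> where "linear L" "0 < \<delta>" "0 \<le> K" and strict: "\<And>t u v. 0 < t \<Longrightarrow> t \<le> \<delta> \<Longrightarrow>
      norm (u - p) \<le> t \<Longrightarrow> norm (v - p) \<le> t \<Longrightarrow> norm (F u - F v - L (u - v)) \<le> K * t * norm (u - v)"
    using assms unfolding strict_derivative_at_def by blast
  show ?thesis
    unfolding has_derivative_at_alt
  proof (intro conjI allI impI)
    show "bounded_linear L" using \<open>linear L\<close> by (simp add: linear_conv_bounded_linear)
    fix e :: real assume "0 < e"
    show "\<exists>d>0. \<forall>y. norm (y - p) < d \<longrightarrow> norm (F y - F p - L (y - p)) \<le> e * norm (y - p)"
    proof (intro exI[of _ "min \<delta> (e / (K + 1))"] conjI allI impI)
      show "0 < min \<delta> (e / (K + 1))" using \<open>0 < \<delta>\<close> \<open>0 \<le> K\<close> \<open>0 < e\<close> by auto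
      fix y assume y: "norm (y - p) < min \<delta> (e / (K + 1))"
      show "norm (F y - F p - L (y - p)) \<le> e * norm (y - p)"
      proof (cases "y = p")
        case True
        then show ?thesis using \<open>linear L\<close> by (simp add: linear_0)
      next
        case False
        have "K * norm (y - p) \<le> K * (e / (K + 1))"
          using y \<open>0 \<le> K\<close> by (intro mult_left_mono) auto
        also have "\<dots> \<le> e" using \<open>0 \<le> K\<close> \<open>0 < e\<close> by (simp add: field_simps)
        finally have "K * norm (y - p) * norm (y - p) \<le> e * norm (y - p)"
          by (simp add: mult_right_mono)
        moreover have "norm (F y - F p - L (y - p)) \<le> K * norm (y - p) * norm (y - p)"
          using strict[of "norm (y - p)" y p] False y by simp
        ultimately show ?thesis by linarith
      qed
    qed
  qed
qed

lemma strict_derivative_at_lipschitz: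
  assumes "strict_derivative_at F L p"
  obtains \<delta> C where "0 < \<delta>"
    and "\<And>u v. norm (u - p) \<le> \<delta> \<Longrightarrow> norm (v - p) \<le> \<delta> \<Longrightarrow> norm (F u - F v) \<le> C * norm (u - v)"
proof -
  obtain K \<delta> where "linear L" "0 < \<delta>" "0 \<le> K" and strict: "\<And>t u v. 0 < t \<Longrightarrow> t \<le> \<delta> \<Longrightarrow>
      norm (u - p) \<le> t \<Longrightarrow> norm (v - p) \<le> t \<Longrightarrow> norm (F u - F v - L (u - v)) \<le> K * t * norm (u - v)"
    using assms unfolding strict_derivative_at_def by blast
  obtain B where B: "\<And>x. norm (L x) \<le> B * norm x" using linear_bounded[OF \<open>linear L\<close>] by blast
  have "norm (F u - F v) \<le> (B + K * \<delta>) * norm (u - v)"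
    if "norm (u - p) \<le> \<delta>" "norm (v - p) \<le> \<delta>" for u v
  proof -
    have "norm (F u - F v) \<le> norm (F u - F v - L (u - v)) + norm (L (u - v))"
      using norm_triangle_sub[of "F u - F v" "L (u - v)"] by linarith
    also have "\<dots> \<le> K * \<delta> * norm (u - v) + B * norm (u - v)"
      using strict \<open>0 < \<delta>\<close> that B by (intro add_mono) auto
    finally show ?thesis by (simp add: algebra_simps)
  qed
  then show thesis using that \<open>0 < \<delta>\<close> by blast
qed

text \<open>One step of Graves' proof of the Lyusternik--Graves theorem: a zero of \<open>F\<close> near \<open>w\<close> is
  the fixed point of the contraction \<open>y \<mapsto> y - F (w + R y)\<close>, \<open>R\<close> a right inverse of \<open>D\<close>.\<close>

lemma zero_near_by_contraction:
  fixes F :: "'a::euclidean_space \<Rightarrow> 'b::euclidean_space"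
  assumes "linear D" "linear R" and DR: "\<And>y. D (R y) = y"
    and "0 < B" and B: "\<And>y. norm (R y) \<le> B * norm y"
    and "0 \<le> \<kappa>" "\<kappa> * B \<le> 1 / 2"
    and contr: "\<And>u v. norm u \<le> t \<Longrightarrow> norm v \<le> t \<Longrightarrow>
                  norm (F u - F v - D (u - v)) \<le> \<kappa> * norm (u - v)"
    and w: "norm w \<le> t / 2" and Fw: "norm (F w) \<le> t / (4 * B)"
  shows "\<exists>m. F m = 0 \<and> norm (m - w) \<le> 2 * B * norm (F w) \<and> norm m \<le> t"
proof -
  define r where "r = 2 * norm (F w)"
  define G where "G y = y - F (w + R y)" for y
  have near: "norm (w + R y) \<le> t" if "y \<in> cball 0 r" for y
  proof -
    have "norm (w + R y) \<le> norm w + B * norm y"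
      using B[of y] norm_triangle_ineq[of w "R y"] by linarith
    also have "\<dots> \<le> t / 2 + B * r" using w that \<open>0 < B\<close> by (intro add_mono mult_left_mono) auto
    also have "\<dots> \<le> t" using Fw \<open>0 < B\<close> by (simp add: r_def field_simps)
    finally show ?thesis .
  qed
  have contraction: "dist (G y) (G y') \<le> 1 / 2 * dist y y'"
    if "y \<in> cball 0 r" "y' \<in> cball 0 r" for y y'
  proof -
    have "dist (G y) (G y') = norm (F (w + R y) - F (w + R y') - D ((w + R y) - (w + R y')))"
      using \<open>linear D\<close> \<open>linear R\<close>
      by (simp add: dist_norm G_def linear_diff DR norm_minus_commute algebra_simps)
    also have "\<dots> \<le> \<kappa> * norm (R (y - y'))"
      using contr[OF near[OF that(1)] near[OF that(2)]] \<open>linear R\<close> by (simp add: linear_diff)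
    also have "\<dots> \<le> \<kappa> * (B * dist y y')"
      using B \<open>0 \<le> \<kappa>\<close> by (intro mult_left_mono) (auto simp: dist_norm)
    also have "\<dots> \<le> 1 / 2 * dist y y'"
      using mult_right_mono[OF \<open>\<kappa> * B \<le> 1 / 2\<close> zero_le_dist[of y y']] by (simp add: mult.assoc)
    finally show ?thesis .
  qed
  have "G ` cball 0 r \<subseteq> cball 0 r"
  proof clarify
    fix y :: 'b assume y: "y \<in> cball 0 r"
    have "G 0 = - F w" using \<open>linear R\<close> by (simp add: G_def linear_0)
    then have "norm (G y) \<le> dist (G y) (G 0) + norm (F w)"
      using norm_triangle_sub[of "G y" "G 0"] by (simp add: dist_norm add.commute)
    also have "\<dots> \<le> 1 / 2 * dist y 0 + norm (F w)"
      using contraction[OF y, of 0] by (auto simp: r_def)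
    also have "\<dots> \<le> r" using y by (simp add: r_def)
    finally show "G y \<in> cball 0 r" by simp
  qed
  then obtain y where y: "y \<in> cball 0 r" "G y = y"
    using Banach_fix[of "cball 0 r" "1 / 2" G] contraction
    by (auto simp: complete_eq_closed r_def)
  have "B * norm y \<le> B * r" using y(1) \<open>0 < B\<close> by (intro mult_left_mono) auto
  then have "norm (R y) \<le> B * r" using B[of y] by linarith
  then have "norm (R y) \<le> 2 * B * norm (F w)" by (simp add: r_def)
  then show ?thesis
    using y near[OF y(1)] by (intro exI[of _ "w + R y"]) (simp add: G_def)
qed

lemma strict_derivative_zeros_near:
  fixes F :: "'a::euclidean_space \<Rightarrow> 'b::euclidean_space"
  assumes "strict_derivative_at F D 0" "F 0 = 0"
    and "linear R" and DR: "\<And>y. D (R y) = y" and "0 < B" and B: "\<And>y. norm (R y) \<le> B * norm y"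
    and "0 < \<epsilon>"
  shows "\<exists>\<eta>>0. \<forall>w. norm w < \<eta> \<longrightarrow> (\<exists>m. F m = 0 \<and> norm (m - w) \<le> 2 * B * norm (F w) \<and> norm m < \<epsilon>)"
proof -
  obtain K \<delta> where "linear D" "0 < \<delta>" "0 \<le> K" and strict: "\<And>t u v. 0 < t \<Longrightarrow> t \<le> \<delta> \<Longrightarrow>
      norm u \<le> t \<Longrightarrow> norm v \<le> t \<Longrightarrow> norm (F u - F v - D (u - v)) \<le> K * t * norm (u - v)"
    using assms(1) unfolding strict_derivative_at_def by auto
  obtain BD where "0 < BD" and BD: "\<And>x. norm (D x) \<le> BD * norm x"
    using linear_bounded_pos[OF \<open>linear D\<close>] by blast
  define t where "t = min (min \<delta> (\<epsilon> / 2)) (1 / (2 * (K + 1) * B))"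
  have "0 < t" "t \<le> \<delta>" "t < \<epsilon>" using \<open>0 < \<delta>\<close> \<open>0 < \<epsilon>\<close> \<open>0 < B\<close> \<open>0 \<le> K\<close> by (auto simp: t_def)
  have "K * t * B \<le> 1 / 2"
  proof -
    have "0 < 2 * (K + 1) * B" using \<open>0 \<le> K\<close> \<open>0 < B\<close> by simp
    moreover have "t \<le> 1 / (2 * (K + 1) * B)" by (simp add: t_def)
    ultimately have "t * (2 * (K + 1) * B) \<le> 1" by (simp add: le_divide_eq)
    moreover have "K * t * B \<le> (K + 1) * t * B" using \<open>0 < t\<close> \<open>0 < B\<close> by simp
    moreover have "(K + 1) * t * B = t * (2 * (K + 1) * B) / 2" by (simp add: algebra_simps)
    ultimately show ?thesis by linarith
  qed
  have "0 < K * t + BD" using \<open>0 < t\<close> \<open>0 \<le> K\<close> \<open>0 < BD\<close> by (simp add: add_nonneg_pos)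
  define \<eta> where "\<eta> = min (t / 2) (t / (4 * B * (K * t + BD)))"
  have "0 < \<eta>" using \<open>0 < t\<close> \<open>0 < B\<close> \<open>0 < K * t + BD\<close> by (simp add: \<eta>_def)
  moreover have "\<exists>m. F m = 0 \<and> norm (m - w) \<le> 2 * B * norm (F w) \<and> norm m < \<epsilon>"
    if "norm w < \<eta>" for w
  proof -
    have w: "norm w \<le> t / 2" using that by (simp add: \<eta>_def)
    have "norm (F w - D w) \<le> K * t * norm w"
      using strict[OF \<open>0 < t\<close> \<open>t \<le> \<delta>\<close>, of w 0] w \<open>0 < t\<close> assms(2) by simp
    then have "norm (F w) \<le> (K * t + BD) * norm w"
      using BD[of w] norm_triangle_sub[of "F w" "D w"] by (simp add: algebra_simps)
    also have "\<dots> \<le> (K * t + BD) * (t / (4 * B * (K * t + BD)))"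
      using that \<open>0 < K * t + BD\<close> by (intro mult_left_mono) (auto simp: \<eta>_def)
    also have "\<dots> = t / (4 * B)" using \<open>0 < K * t + BD\<close> by simp
    finally have "norm (F w) \<le> t / (4 * B)" .
    then show ?thesis
      using zero_near_by_contraction[OF \<open>linear D\<close> \<open>linear R\<close> DR \<open>0 < B\<close> B _
          \<open>K * t * B \<le> 1 / 2\<close> strict[OF \<open>0 < t\<close> \<open>t \<le> \<delta>\<close>] w] \<open>0 \<le> K\<close> \<open>0 < t\<close> \<open>t < \<epsilon>\<close>
      by fastforce
  qed
  ultimately show ?thesis by blast
qed

text \<open>The Lyusternik--Graves theorem (metric regularity of submersions).\<close>

lemma strict_derivative_surj_metric_regular:
  fixes F :: "'a::euclidean_space \<Rightarrow> 'b::euclidean_space"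
  assumes "strict_derivative_at F D 0" "surj D" "F 0 = 0"
  shows "\<exists>C. \<forall>\<epsilon>>0. \<exists>\<eta>>0. \<forall>w. norm w < \<eta> \<longrightarrow>
           (\<exists>m. F m = 0 \<and> norm (m - w) \<le> C * norm (F w) \<and> norm m < \<epsilon>)"
proof -
  have "linear D" using assms(1) by (simp add: strict_derivative_at_def)
  obtain R where "linear R" and "D \<circ> R = id"
    using real_vector.linear_surjective_right_inverse[OF \<open>linear D\<close> assms(2)] by blast
  then have "D (R y) = y" for y by (metis comp_apply id_apply)
  obtain B where "0 < B" "\<And>y. norm (R y) \<le> B * norm y"
    using linear_bounded_pos[OF \<open>linear R\<close>] by blast
  then show ?thesis
    using strict_derivative_zeros_near[OF assms(1,3) \<open>linear R\<close> \<open>D (R _) = _\<close>] by blast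
qed

section \<open>Polynomials in several complex variables\<close>

lemma finite_multi_indices_le: "finite {\<beta>::'a::finite \<Rightarrow> nat. sum \<beta> UNIV \<le> k}"
proof (rule finite_subset)
  show "{\<beta>::'a \<Rightarrow> nat. sum \<beta> UNIV \<le> k} \<subseteq> PiE UNIV (\<lambda>_. {..k})"
  proof
    fix \<beta> :: "'a \<Rightarrow> nat" assume "\<beta> \<in> {\<beta>. sum \<beta> UNIV \<le> k}"
    then have "\<beta> i \<le> k" for i using member_le_sum[of i UNIV \<beta>] by auto
    then show "\<beta> \<in> PiE UNIV (\<lambda>_. {..k})" by (auto simp: PiE_def extensional_def)
  qed
  show "finite (PiE (UNIV::'a set) (\<lambda>_. {..k}))" by (intro finite_PiE) auto
qed

lemma finite_multi_indices_less: "finite {\<beta>::'a::finite \<Rightarrow> nat. sum \<beta> UNIV < k}"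
  by (rule finite_subset[OF _ finite_multi_indices_le[of k]]) auto

lemma finite_multi_indices_eq: "finite {\<beta>::'a::finite \<Rightarrow> nat. sum \<beta> UNIV = k}"
  by (rule finite_subset[OF _ finite_multi_indices_le[of k]]) auto

lemma power_sum_eq_0_imp_coeff_eq_0:
  fixes A :: "nat \<Rightarrow> complex"
  assumes "finite N" "\<And>w. (\<Sum>n\<in>N. A n * w ^ n) = 0" "n \<in> N"
  shows "A n = 0"
proof -
  define c where "c i = (if i \<in> N then A i else 0)" for i
  have "(\<Sum>i\<le>Max N. c i * w ^ i) = (\<Sum>i\<in>N. A i * w ^ i)" for w
    by (rule sum.mono_neutral_cong_right) (use assms in \<open>auto simp: c_def\<close>)
  then have "c n = 0" using assms zero_polynom_imp_zero_coeffs[of c "Max N" n] by auto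
  then show ?thesis using assms by (simp add: c_def)
qed

lemma inj_on_restrict_fixed_value:
  assumes "inj_on (\<lambda>\<beta>. restrict \<beta> (insert j I)) S"
  shows "inj_on (\<lambda>\<gamma>. restrict \<gamma> I) {\<gamma>\<in>S. \<gamma> j = n}"
proof (rule inj_onI)
  fix \<gamma> \<gamma>' assume \<gamma>: "\<gamma> \<in> {\<gamma>\<in>S. \<gamma> j = n}" "\<gamma>' \<in> {\<gamma>\<in>S. \<gamma> j = n}"
    and "restrict \<gamma> I = restrict \<gamma>' I"
  then have "\<gamma> i = \<gamma>' i" if "i \<in> insert j I" for i
    using that by auto (metis restrict_apply')
  then have "restrict \<gamma> (insert j I) = restrict \<gamma>' (insert j I)" by auto
  moreover have "\<gamma> \<in> S" "\<gamma>' \<in> S" using \<gamma> by auto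
  ultimately show "\<gamma> = \<gamma>'" by (rule inj_onD[OF assms])
qed

text \<open>Stated for multi-indices that are only distinguished by their restriction to \<open>I\<close>, so that
  the induction on \<open>I\<close> needs no reindexing: grouping by the exponent of a new variable \<open>j\<close>
  leaves groups that are distinguished on \<open>I\<close>.\<close>

lemma polynomial_coeffs_eq_0:
  fixes c :: "('a \<Rightarrow> nat) \<Rightarrow> complex"
  assumes "finite I" "finite S" "inj_on (\<lambda>\<beta>. restrict \<beta> I) S"
    and "\<And>z. (\<Sum>\<beta>\<in>S. c \<beta> * (\<Prod>i\<in>I. z i ^ \<beta> i)) = 0" and "\<beta> \<in> S"
  shows "c \<beta> = 0"
  using assms
proof (induction I arbitrary: S rule: finite_induct)
  case empty
  then have "S = {\<beta>}" by (auto simp: inj_on_def)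
  then show ?case using empty.prems(3) by simp
next
  case (insert j I)
  define Sn where "Sn n = {\<gamma>\<in>S. \<gamma> j = n}" for n
  have group_vanishes: "(\<Sum>\<gamma>\<in>Sn (\<beta> j). c \<gamma> * (\<Prod>i\<in>I. z i ^ \<gamma> i)) = 0" for z
  proof (rule power_sum_eq_0_imp_coeff_eq_0)
    show "finite ((\<lambda>\<gamma>. \<gamma> j) ` S)" "\<beta> j \<in> (\<lambda>\<gamma>. \<gamma> j) ` S" using insert.prems by auto
    fix w :: complex
    have "(\<Prod>i\<in>I. (z(j := w)) i ^ \<gamma> i) = (\<Prod>i\<in>I. z i ^ \<gamma> i)" for \<gamma>
      using insert.hyps by (intro prod.cong) auto
    then have upd: "c \<gamma> * (\<Prod>i\<in>I. z i ^ \<gamma> i) * w ^ n = c \<gamma> * (\<Prod>i\<in>insert j I. (z(j := w)) i ^ \<gamma> i)"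
      if "\<gamma> \<in> Sn n" for \<gamma> n
      using insert.hyps that by (simp add: Sn_def mult_ac)
    have "(\<Sum>\<gamma>\<in>Sn n. c \<gamma> * (\<Prod>i\<in>I. z i ^ \<gamma> i)) * w ^ n
        = (\<Sum>\<gamma>\<in>Sn n. c \<gamma> * (\<Prod>i\<in>insert j I. (z(j := w)) i ^ \<gamma> i))" for n
      unfolding sum_distrib_right by (intro sum.cong refl upd)
    then have "(\<Sum>n\<in>(\<lambda>\<gamma>. \<gamma> j) ` S. (\<Sum>\<gamma>\<in>Sn n. c \<gamma> * (\<Prod>i\<in>I. z i ^ \<gamma> i)) * w ^ n)
        = (\<Sum>n\<in>(\<lambda>\<gamma>. \<gamma> j) ` S. \<Sum>\<gamma>\<in>Sn n. c \<gamma> * (\<Prod>i\<in>insert j I. (z(j := w)) i ^ \<gamma> i))"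
      by simp
    also have "\<dots> = (\<Sum>\<gamma>\<in>S. c \<gamma> * (\<Prod>i\<in>insert j I. (z(j := w)) i ^ \<gamma> i))"
      unfolding Sn_def by (rule sum.group) (use insert.prems in auto)
    also have "\<dots> = 0" by (rule insert.prems)
    finally show "(\<Sum>n\<in>(\<lambda>\<gamma>. \<gamma> j) ` S. (\<Sum>\<gamma>\<in>Sn n. c \<gamma> * (\<Prod>i\<in>I. z i ^ \<gamma> i)) * w ^ n) = 0" .
  qed
  have group_inj: "inj_on (\<lambda>\<gamma>. restrict \<gamma> I) (Sn (\<beta> j))"
    unfolding Sn_def by (rule inj_on_restrict_fixed_value[OF insert.prems(2)])
  show ?case
  proof (rule insert.IH[OF _ group_inj group_vanishes])
    show "finite (Sn (\<beta> j))" "\<beta> \<in> Sn (\<beta> j)" using insert.prems by (auto simp: Sn_def)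
  qed
qed

lemma monom_coeffs_eq_0:
  fixes c :: "('a::finite \<Rightarrow> nat) \<Rightarrow> complex"
  assumes "finite S" "\<And>z. (\<Sum>\<beta>\<in>S. c \<beta> * monom \<beta> z) = 0" "\<beta> \<in> S"
  shows "c \<beta> = 0"
proof (rule polynomial_coeffs_eq_0[of UNIV S])
  fix z :: "'a \<Rightarrow> complex"
  show "(\<Sum>\<beta>\<in>S. c \<beta> * (\<Prod>i\<in>UNIV. z i ^ \<beta> i)) = 0"
    using assms(2)[of "\<chi> i. z i"] by (simp add: monom_def)
qed (use assms in \<open>simp_all add: restrict_UNIV\<close>)

lemma tendsto_monom [tendsto_intros]:
  "(f \<longlongrightarrow> v) F \<Longrightarrow> ((\<lambda>t. monom \<beta> (f t)) \<longlongrightarrow> monom \<beta> v) F"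
  unfolding monom_def by (intro tendsto_prod tendsto_power tendsto_vec_nth)

lemma scaleR_vec_complex: "t *\<^sub>R v = complex_of_real t *s (v :: complex^'n)"
proof -
  have "(t *\<^sub>R v) $ i = complex_of_real t * v $ i" for i
    by (subst vector_scaleR_component) (rule scaleR_conv_of_real)
  then show ?thesis by (simp add: vec_eq_iff)
qed

lemma monom_scaleR: "monom \<beta> (t *\<^sub>R v) = complex_of_real t ^ sum \<beta> UNIV * monom \<beta> v"
  by (simp add: scaleR_vec_complex monom_def power_mult_distrib prod.distrib power_sum)

lemma has_derivative_ray_quotient:
  fixes Y :: "'x::real_normed_vector \<Rightarrow> 'y::real_normed_vector"
  assumes "(Y has_derivative L) (at 0)" "Y 0 = 0"
  shows "((\<lambda>t. inverse t *\<^sub>R Y (t *\<^sub>R x)) \<longlongrightarrow> L x) (at_right 0)"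
proof -
  have "((\<lambda>t::real. t *\<^sub>R x) has_derivative (\<lambda>t. t *\<^sub>R x)) (at 0)"
    by (intro derivative_eq_intros) auto
  moreover have "(Y has_derivative L) (at ((\<lambda>t::real. t *\<^sub>R x) 0))" using assms(1) by simp
  ultimately have "((\<lambda>t. Y (t *\<^sub>R x)) has_derivative (\<lambda>t. L (t *\<^sub>R x))) (at 0)"
    by (rule has_derivative_compose)
  then have "((\<lambda>t. norm (Y (t *\<^sub>R x) - L (t *\<^sub>R x)) / norm t) \<longlongrightarrow> 0) (at 0)"
    using assms(2) by (simp add: has_derivative_iff_norm)
  then have "((\<lambda>t. norm (Y (t *\<^sub>R x) - L (t *\<^sub>R x)) / norm t) \<longlongrightarrow> 0) (at_right 0)"
    by (rule tendsto_mono[rotated]) (simp add: at_le)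
  moreover have "\<forall>\<^sub>F t in at_right 0.
      norm (Y (t *\<^sub>R x) - L (t *\<^sub>R x)) / norm t = norm (inverse t *\<^sub>R Y (t *\<^sub>R x) - L x)"
    using eventually_at_right_less
  proof eventually_elim
    case (elim t)
    have "L (t *\<^sub>R x) = t *\<^sub>R L x"
      using has_derivative_bounded_linear[OF assms(1)] by (simp add: linear_cmul bounded_linear.linear)
    then have "inverse t *\<^sub>R Y (t *\<^sub>R x) - L x = inverse t *\<^sub>R (Y (t *\<^sub>R x) - L (t *\<^sub>R x))"
      using elim by (simp add: scaleR_diff_right)
    then show ?case using elim by (simp add: divide_inverse mult.commute)
  qed
  ultimately have "((\<lambda>t. norm (inverse t *\<^sub>R Y (t *\<^sub>R x) - L x)) \<longlongrightarrow> 0) (at_right 0)"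
    by (rule Lim_transform_eventually)
  then show ?thesis by (simp add: tendsto_norm_zero_iff LIM_zero_cancel)
qed

lemma polynomial_scaleR_lowest_degree:
  fixes c :: "('a::finite \<Rightarrow> nat) \<Rightarrow> complex"
  assumes lower: "\<And>\<beta>. sum \<beta> UNIV < m \<Longrightarrow> c \<beta> = 0"
  shows "(\<Sum>\<beta>\<in>{\<beta>. sum \<beta> UNIV < k}. c \<beta> * monom \<beta> (t *\<^sub>R v))
    = complex_of_real t ^ m * (\<Sum>\<beta>\<in>{\<beta>. m \<le> sum \<beta> UNIV \<and> sum \<beta> UNIV < k}.
        c \<beta> * complex_of_real t ^ (sum \<beta> UNIV - m) * monom \<beta> v)"
proof -
  have "(\<Sum>\<beta>\<in>{\<beta>. sum \<beta> UNIV < k}. c \<beta> * monom \<beta> (t *\<^sub>R v))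
      = (\<Sum>\<beta>\<in>{\<beta>. m \<le> sum \<beta> UNIV \<and> sum \<beta> UNIV < k}. c \<beta> * monom \<beta> (t *\<^sub>R v))"
  proof (rule sum.mono_neutral_right[OF finite_multi_indices_less])
    show "\<forall>\<beta>\<in>{\<beta>. sum \<beta> UNIV < k} - {\<beta>. m \<le> sum \<beta> UNIV \<and> sum \<beta> UNIV < k}.
        c \<beta> * monom \<beta> (t *\<^sub>R v) = 0"
    proof
      fix \<beta> :: "'a \<Rightarrow> nat"
      assume "\<beta> \<in> {\<beta>. sum \<beta> UNIV < k} - {\<beta>. m \<le> sum \<beta> UNIV \<and> sum \<beta> UNIV < k}"
      then have "c \<beta> = 0" using lower by (auto simp: not_le)
      then show "c \<beta> * monom \<beta> (t *\<^sub>R v) = 0" by simp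
    qed
  qed auto
  also have "\<dots> = complex_of_real t ^ m * (\<Sum>\<beta>\<in>{\<beta>. m \<le> sum \<beta> UNIV \<and> sum \<beta> UNIV < k}.
        c \<beta> * complex_of_real t ^ (sum \<beta> UNIV - m) * monom \<beta> v)"
    unfolding sum_distrib_left
  proof (intro sum.cong refl)
    fix \<beta> :: "'a \<Rightarrow> nat" assume "\<beta> \<in> {\<beta>. m \<le> sum \<beta> UNIV \<and> sum \<beta> UNIV < k}"
    then have "complex_of_real t ^ sum \<beta> UNIV
        = complex_of_real t ^ m * complex_of_real t ^ (sum \<beta> UNIV - m)"
      by (simp add: power_add[symmetric])
    then show "c \<beta> * monom \<beta> (t *\<^sub>R v)
        = complex_of_real t ^ m * (c \<beta> * complex_of_real t ^ (sum \<beta> UNIV - m) * monom \<beta> v)"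
      by (simp add: monom_scaleR mult_ac)
  qed
  finally show ?thesis .
qed

text \<open>Along the ray \<open>t x\<close> the polynomial equals \<open>t\<^sup>m E(t)\<close> with \<open>E(t) \<rightarrow> P\<^sub>m(L x)\<close> as
  \<open>t \<rightarrow> 0\<^sup>+\<close>, where \<open>P\<^sub>m\<close> is its part of degree \<open>m\<close>; the bound \<open>O(t\<^sup>k)\<close> forces \<open>E(t) \<rightarrow> 0\<close>.\<close>

lemma polynomial_bigO_homogeneous_part_eq_0:
  fixes Y :: "'x::real_normed_vector \<Rightarrow> complex^'a::finite"
  assumes Y: "(Y has_derivative L) (at 0)" "Y 0 = 0"
    and "m < k" and lower: "\<And>\<beta>. sum \<beta> UNIV < m \<Longrightarrow> c \<beta> = 0"
    and big: "bigO_pow (\<lambda>x. \<Sum>\<beta>\<in>{\<beta>. sum \<beta> UNIV < k}. c \<beta> * monom \<beta> (Y x)) k"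
  shows "(\<Sum>\<beta>\<in>{\<beta>. sum \<beta> UNIV = m}. c \<beta> * monom \<beta> (L x)) = 0"
proof -
  define q where "q t = inverse t *\<^sub>R Y (t *\<^sub>R x)" for t :: real
  define T where "T = {\<beta>::'a \<Rightarrow> nat. m \<le> sum \<beta> UNIV \<and> sum \<beta> UNIV < k}"
  define E where "E t = (\<Sum>\<beta>\<in>T. c \<beta> * complex_of_real t ^ (sum \<beta> UNIV - m) * monom \<beta> (q t))"
    for t
  have "finite T" by (rule finite_subset[OF _ finite_multi_indices_less[of k]]) (auto simp: T_def)
  have "(E \<longlongrightarrow> (\<Sum>\<beta>\<in>T. c \<beta> * complex_of_real 0 ^ (sum \<beta> UNIV - m) * monom \<beta> (L x))) (at_right 0)"
    unfolding E_def q_def using Y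
    by (intro tendsto_intros tendsto_ident_at has_derivative_ray_quotient)
  also have "(\<Sum>\<beta>\<in>T. c \<beta> * complex_of_real 0 ^ (sum \<beta> UNIV - m) * monom \<beta> (L x))
      = (\<Sum>\<beta>\<in>{\<beta>. sum \<beta> UNIV = m}. c \<beta> * monom \<beta> (L x))"
    using \<open>finite T\<close> \<open>m < k\<close>
    by (intro sum.mono_neutral_cong_right) (auto simp: T_def power_0_left)
  finally have E_lim: "(E \<longlongrightarrow> (\<Sum>\<beta>\<in>{\<beta>. sum \<beta> UNIV = m}. c \<beta> * monom \<beta> (L x))) (at_right 0)" .
  obtain C where C: "\<forall>\<^sub>F y in nhds 0.
      norm (\<Sum>\<beta>\<in>{\<beta>. sum \<beta> UNIV < k}. c \<beta> * monom \<beta> (Y y)) \<le> C * norm y ^ k"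
    using big unfolding bigO_pow_def by blast
  have "((\<lambda>t. t *\<^sub>R x) \<longlongrightarrow> 0 *\<^sub>R x) (at_right (0::real))"
    by (intro tendsto_intros)
  then have "filterlim (\<lambda>t. t *\<^sub>R x) (nhds 0) (at_right (0::real))" by simp
  from eventually_compose_filterlim[OF C this]
  have "\<forall>\<^sub>F t in at_right 0. norm (E t) \<le> C * norm x ^ k * t ^ (k - m)"
    using eventually_at_right_less[of "0::real"]
  proof eventually_elim
    case (elim t)
    have "Y (t *\<^sub>R x) = t *\<^sub>R q t" using elim by (simp add: q_def)
    then have "(\<Sum>\<beta>\<in>{\<beta>. sum \<beta> UNIV < k}. c \<beta> * monom \<beta> (Y (t *\<^sub>R x))) = complex_of_real t ^ m * E t"
      unfolding E_def T_def by (simp add: polynomial_scaleR_lowest_degree[OF lower])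
    then have "t ^ m * norm (E t) \<le> C * (t ^ k * norm x ^ k)"
      using elim by (simp add: norm_mult norm_power power_mult_distrib)
    also have "\<dots> = t ^ m * (C * norm x ^ k * t ^ (k - m))"
      using \<open>m < k\<close> by (simp add: power_add[symmetric] mult_ac)
    finally show ?case using elim by simp
  qed
  moreover have "((\<lambda>t::real. t ^ (k - m)) \<longlongrightarrow> 0 ^ (k - m)) (at_right 0)"
    by (intro tendsto_intros)
  then have "((\<lambda>t::real. t ^ (k - m)) \<longlongrightarrow> 0) (at_right 0)" using \<open>m < k\<close> by simp
  then have "((\<lambda>t. C * norm x ^ k * t ^ (k - m)) \<longlongrightarrow> 0) (at_right 0)"
    by (rule tendsto_mult_right_zero)
  ultimately have "(E \<longlongrightarrow> 0) (at_right 0)" by (rule Lim_null_comparison)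
  with E_lim show ?thesis using tendsto_unique[OF trivial_limit_at_right_real] by blast
qed

lemma polynomial_eq_0_on_complexification:
  fixes L :: "'x::real_vector \<Rightarrow> complex^'a::finite"
  assumes "linear L" and spans: "\<forall>w. \<exists>x y. w = L x + \<i> *s L y"
    and vanishes: "\<And>x. (\<Sum>\<beta>\<in>S. c \<beta> * monom \<beta> (L x)) = 0"
  shows "(\<Sum>\<beta>\<in>S. c \<beta> * monom \<beta> w) = 0"
proof -
  obtain x y where w: "w = L x + \<i> *s L y" using spans by blast
  define g where "g z = (\<Sum>\<beta>\<in>S. c \<beta> * (\<Prod>i\<in>UNIV. (L x $ i + z * L y $ i) ^ \<beta> i))" for z
  have g: "g z = (\<Sum>\<beta>\<in>S. c \<beta> * monom \<beta> (L x + z *s L y))" for z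
    by (simp add: g_def monom_def)
  have "L x + complex_of_real r *s L y = L (x + r *\<^sub>R y)" for r
    using \<open>linear L\<close> by (simp add: linear_add linear_cmul scaleR_vec_complex)
  then have "g (complex_of_real r) = 0" for r
    using vanishes[of "x + r *\<^sub>R y"] by (simp add: g)
  then have vanish_real: "g z = 0" if "z \<in> \<real>" for z
    using that by (auto elim: Reals_cases)
  have "0 islimpt (\<real> :: complex set)"
    unfolding islimpt_approachable
  proof (intro allI impI)
    fix e :: real assume "0 < e"
    then show "\<exists>z\<in>\<real>. z \<noteq> 0 \<and> dist z (0::complex) < e"
      by (intro bexI[of _ "complex_of_real (e / 2)"]) auto
  qed
  moreover have "g holomorphic_on UNIV" unfolding g_def by (intro holomorphic_intros)
  ultimately have "g \<i> = 0"
    by (intro analytic_continuation[of g UNIV \<real> 0, OF _ open_UNIV connected_UNIV subset_UNIV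
          UNIV_I _ vanish_real UNIV_I])
  then show ?thesis using w by (simp add: g)
qed

lemma polynomial_bigO_coeffs_eq_0:
  fixes Y :: "'x::real_normed_vector \<Rightarrow> complex^'a::finite"
  assumes Y: "(Y has_derivative L) (at 0)" "Y 0 = 0"
    and spans: "\<forall>w. \<exists>x y. w = L x + \<i> *s L y"
    and big: "bigO_pow (\<lambda>x. \<Sum>\<beta>\<in>{\<beta>. sum \<beta> UNIV < k}. c \<beta> * monom \<beta> (Y x)) k"
    and "sum \<beta> UNIV < k"
  shows "c \<beta> = 0"
proof -
  have "linear L" using has_derivative_bounded_linear[OF Y(1)] by (simp add: bounded_linear.linear)
  have "\<forall>\<beta>. sum \<beta> UNIV = m \<longrightarrow> c \<beta> = 0" if "m < k" for m
    using that
  proof (induction m rule: less_induct)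
    case (less m)
    have "(\<Sum>\<beta>\<in>{\<beta>. sum \<beta> UNIV = m}. c \<beta> * monom \<beta> (L x)) = 0" for x
      using less by (intro polynomial_bigO_homogeneous_part_eq_0[OF Y _ _ big]) auto
    then have "(\<Sum>\<beta>\<in>{\<beta>. sum \<beta> UNIV = m}. c \<beta> * monom \<beta> w) = 0" for w
      by (rule polynomial_eq_0_on_complexification[OF \<open>linear L\<close> spans])
    then show ?case using monom_coeffs_eq_0[OF finite_multi_indices_eq] by blast
  qed
  then show ?thesis using assms(5) by blast
qed

section \<open>Tangent spaces of generic submanifolds\<close>

lemma surj_if_orthogonal_range_trivial:
  fixes f :: "'a::euclidean_space \<Rightarrow> 'b::euclidean_space"
  assumes "linear f" and orth: "\<And>c. (\<forall>v. c \<bullet> f v = 0) \<Longrightarrow> c = 0"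
  shows "surj f"
proof (rule ccontr)
  assume "\<not> surj f"
  have "subspace (range f)" by (rule linear_subspace_image[OF \<open>linear f\<close> subspace_UNIV])
  have "dim (range f) \<noteq> DIM('b)"
  proof
    assume "dim (range f) = DIM('b)"
    then have "span (range f) = UNIV" by (simp add: dim_eq_full)
    then show False using \<open>subspace (range f)\<close> \<open>\<not> surj f\<close> by (metis span_eq_iff)
  qed
  then have "dim (range f) < DIM('b)" using dim_subset_UNIV[of "range f"] by linarith
  then obtain c where "c \<noteq> 0" "\<And>y. y \<in> span (range f) \<Longrightarrow> orthogonal c y"
    using orthogonal_to_subspace_exists by blast
  then have "\<forall>v. c \<bullet> f v = 0" by (simp add: orthogonal_def span_base)
  then show False using orth \<open>c \<noteq> 0\<close> by blast
qed

lemma range_eq_kernel_if_dim_eq: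
  fixes L :: "'a::euclidean_space \<Rightarrow> 'c::euclidean_space" and \<Phi> :: "'c \<Rightarrow> 'b::euclidean_space"
  assumes "linear L" "inj L" "linear \<Phi>" "surj \<Phi>" "\<And>x. \<Phi> (L x) = 0"
    and dim: "DIM('a) + DIM('b) = DIM('c)"
    and "\<Phi> v = 0"
  shows "\<exists>x. v = L x"
proof -
  obtain R where "linear R" and "\<Phi> \<circ> R = id"
    using real_vector.linear_surjective_right_inverse[OF \<open>linear \<Phi>\<close> \<open>surj \<Phi>\<close>] by blast
  then have \<Phi>R: "\<Phi> (R y) = y" for y by (metis comp_apply id_apply)
  then have "inj R" by (metis injI)
  have "range L \<inter> range R \<subseteq> {0}"
  proof
    fix u assume "u \<in> range L \<inter> range R"
    then obtain x y where "u = L x" "u = R y" by blast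
    then have "y = 0" using \<Phi>R assms(5) by metis
    then show "u \<in> {0}" using \<open>u = R y\<close> \<open>linear R\<close> by (simp add: linear_0)
  qed
  then have "dim (range L \<inter> range R) = 0" by (simp add: dim_eq_0)
  moreover have "dim (range L) = DIM('a)" "dim (range R) = DIM('b)"
    using dim_image_eq[OF \<open>linear L\<close>, of UNIV] dim_image_eq[OF \<open>linear R\<close>, of UNIV]
      \<open>inj L\<close> \<open>inj R\<close> by (auto simp: inj_on_def)
  moreover have subspaces: "subspace (range L)" "subspace (range R)"
    using linear_subspace_image subspace_UNIV \<open>linear L\<close> \<open>linear R\<close> by blast+
  ultimately have "dim {x + y |x y. x \<in> range L \<and> y \<in> range R} = DIM('c)"
    using dim_sums_Int[OF subspaces] dim by linarith
  then have "span {x + y |x y. x \<in> range L \<and> y \<in> range R} = UNIV"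
    by (rule dim_eq_full[THEN iffD1])
  then have "{x + y |x y. x \<in> range L \<and> y \<in> range R} = UNIV"
    using span_eq_iff[THEN iffD2, OF subspace_sums[OF subspaces]] by simp
  then obtain x y where xy: "v = L x + R y" by blast
  then have "y = 0"
    using \<open>linear \<Phi>\<close> \<open>\<Phi> v = 0\<close> \<Phi>R assms(5) by (simp add: linear_add)
  then show ?thesis using xy \<open>linear R\<close> by (auto simp: linear_0)
qed

definition cdot :: "complex^'a \<Rightarrow> complex^'a \<Rightarrow> complex" where
  "cdot g v = (\<Sum>l\<in>UNIV. g $ l * v $ l)"

lemma cdot_add: "cdot g (u + v) = cdot g u + cdot g v"
  by (simp add: cdot_def sum.distrib algebra_simps)

lemma cdot_diff: "cdot g (u - v) = cdot g u - cdot g v"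
  by (simp add: cdot_def sum_subtractf algebra_simps)

lemma cdot_smult: "cdot g (c *s v) = c * cdot g v"
  by (simp add: cdot_def sum_distrib_left mult_ac)

lemma cdot_scaleR: "cdot g (r *\<^sub>R v) = complex_of_real r * cdot g v"
  by (simp add: scaleR_vec_complex cdot_smult)

text \<open>The complex gradient \<open>(\<partial>\<phi>/\<partial>Z\<^sub>1, \<dots>, \<partial>\<phi>/\<partial>Z\<^sub>m)\<close> of a real-linear functional.\<close>

definition complex_gradient :: "(complex^'a \<Rightarrow> real) \<Rightarrow> complex^'a" where
  "complex_gradient \<phi> =
     (\<chi> l. (complex_of_real (\<phi> (axis l 1)) - \<i> * complex_of_real (\<phi> (axis l \<i>))) / 2)"

lemma cgrad_eq_complex_gradient: "cgrad f Z = complex_gradient (frechet_derivative f (at Z))"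
  by (simp add: cgrad_def complex_gradient_def)

lemma vec_complex_decomposition:
  fixes v :: "complex^'a::finite"
  shows "v = (\<Sum>l\<in>UNIV. Re (v $ l) *\<^sub>R axis l 1 + Im (v $ l) *\<^sub>R axis l \<i>)"
proof (subst vec_eq_iff, intro allI)
  fix i
  have "(\<Sum>l\<in>UNIV. Re (v $ l) *\<^sub>R axis l 1 + Im (v $ l) *\<^sub>R axis l \<i>) $ i
      = (\<Sum>l\<in>UNIV. if l = i then Re (v $ l) *\<^sub>R 1 + Im (v $ l) *\<^sub>R \<i> else 0)"
    unfolding sum_component by (rule sum.cong) (auto simp: axis_def)
  also have "\<dots> = Re (v $ i) *\<^sub>R 1 + Im (v $ i) *\<^sub>R \<i>" by simp
  also have "\<dots> = v $ i" by (simp add: complex_eq_iff)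
  finally show "v $ i = (\<Sum>l\<in>UNIV. Re (v $ l) *\<^sub>R axis l 1 + Im (v $ l) *\<^sub>R axis l \<i>) $ i" by simp
qed

lemma linear_eq_Re_cdot_complex_gradient:
  fixes \<phi> :: "complex^'a::finite \<Rightarrow> real"
  assumes "linear \<phi>"
  shows "\<phi> v = 2 * Re (cdot (complex_gradient \<phi>) v)"
proof -
  have "\<phi> v = \<phi> (\<Sum>l\<in>UNIV. Re (v $ l) *\<^sub>R axis l 1 + Im (v $ l) *\<^sub>R axis l \<i>)"
    by (subst vec_complex_decomposition) (rule refl)
  also have "\<dots> = (\<Sum>l\<in>UNIV. Re (v $ l) * \<phi> (axis l 1) + Im (v $ l) * \<phi> (axis l \<i>))"
    using assms by (simp add: linear_sum linear_add linear_cmul)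
  also have "\<dots> = 2 * Re (cdot (complex_gradient \<phi>) v)"
    by (simp add: cdot_def complex_gradient_def Re_sum sum_divide_distrib[symmetric] algebra_simps)
  finally show ?thesis .
qed

text \<open>With \<open>\<psi>\<^sub>j = cdot (G j)\<close>: if \<open>\<Sum> a\<^sub>j Re \<psi>\<^sub>j + b\<^sub>j Im \<psi>\<^sub>j\<close> vanishes, it is the real part of the \<open>\<complex>\<close>-linear
  functional \<open>\<Sum> (a\<^sub>j - i b\<^sub>j) \<psi>\<^sub>j\<close>, which then vanishes too.\<close>

lemma surj_Re_Im_cdot:
  fixes G :: "'d::finite \<Rightarrow> complex^'a::finite"
  assumes indep: "\<And>c. (\<Sum>j\<in>UNIV. c j *s G j) = 0 \<Longrightarrow> \<forall>j. c j = 0"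
  shows "surj (\<lambda>v. ((\<chi> j. Re (cdot (G j) v)), (\<chi> j. Im (cdot (G j) v))))"
    (is "surj ?\<Psi>")
proof (rule surj_if_orthogonal_range_trivial)
  show "linear ?\<Psi>"
    by (rule linearI) (simp_all add: vec_eq_iff cdot_add cdot_scaleR)
  fix c :: "(real^'d) \<times> (real^'d)" assume c: "\<forall>v. c \<bullet> ?\<Psi> v = 0"
  obtain a b where ab: "c = (a, b)" by (cases c)
  define \<gamma> where "\<gamma> j = complex_of_real (a $ j) - \<i> * complex_of_real (b $ j)" for j
  define \<mu> where "\<mu> v = (\<Sum>j\<in>UNIV. \<gamma> j * cdot (G j) v)" for v
  have Re_\<mu>: "Re (\<mu> v) = 0" for v
  proof -
    have "Re (\<mu> v) = c \<bullet> ?\<Psi> v"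
      by (simp add: \<mu>_def \<gamma>_def ab Re_sum inner_vec_def sum.distrib algebra_simps)
    then show ?thesis using c by simp
  qed
  have "\<mu> v = 0" for v
  proof -
    have "\<mu> (\<i> *s v) = \<i> * \<mu> v" by (simp add: \<mu>_def cdot_smult sum_distrib_left mult_ac)
    then show ?thesis using Re_\<mu>[of v] Re_\<mu>[of "\<i> *s v"] by (simp add: complex_eq_iff)
  qed
  then have "(\<Sum>j\<in>UNIV. \<gamma> j *s G j) $ l = 0" for l
    using \<open>\<mu> (axis l 1) = 0\<close>
    by (simp add: \<mu>_def cdot_def axis_def sum_component if_distrib[of "\<lambda>z. _ * z"] sum.delta
        cong: if_cong)
  then have "\<forall>j. \<gamma> j = 0" by (intro indep) (simp add: vec_eq_iff)
  then show "c = 0" by (simp add: ab \<gamma>_def vec_eq_iff complex_eq_iff zero_prod_def)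
qed

text \<open>By counting dimensions, \<open>T = range L\<close> is the common kernel of the \<open>\<phi>\<^sub>j = 2 Re \<psi>\<^sub>j\<close>;
  then \<open>w = (w - i v) + i v\<close> with \<open>v, w - i v \<in> T\<close> once \<open>\<psi>(v) = -i Re \<psi>(w)\<close>.\<close>

lemma generic_tangent_space_spans:
  fixes L :: "real^'p::finite \<Rightarrow> complex^'a::finite" and \<phi> :: "'d::finite \<Rightarrow> complex^'a \<Rightarrow> real"
  assumes "linear L" "inj L" and card: "CARD('p) + CARD('d) = 2 * CARD('a)"
    and lin: "\<And>j. linear (\<phi> j)"
    and real_indep: "\<And>c::'d \<Rightarrow> real. (\<forall>v. (\<Sum>j\<in>UNIV. c j * \<phi> j v) = 0) \<Longrightarrow> \<forall>j. c j = 0"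
    and complex_indep: "\<And>c::'d \<Rightarrow> complex.
           (\<Sum>j\<in>UNIV. c j *s complex_gradient (\<phi> j)) = 0 \<Longrightarrow> \<forall>j. c j = 0"
    and tangent: "\<And>x j. \<phi> j (L x) = 0"
  shows "\<forall>w. \<exists>x y. w = L x + \<i> *s L y"
proof
  fix w
  define \<psi> where "\<psi> j = cdot (complex_gradient (\<phi> j))" for j
  have \<phi>_\<psi>: "\<phi> j v = 2 * Re (\<psi> j v)" for j v
    unfolding \<psi>_def by (rule linear_eq_Re_cdot_complex_gradient[OF lin])
  define \<Phi> where "\<Phi> v = (\<chi> j. \<phi> j v)" for v
  have "linear \<Phi>"
    by (rule linearI) (simp_all add: \<Phi>_def vec_eq_iff linear_add[OF lin] linear_cmul[OF lin])
  moreover have "surj \<Phi>"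
  proof (rule surj_if_orthogonal_range_trivial[OF \<open>linear \<Phi>\<close>])
    fix c :: "real^'d" assume "\<forall>v. c \<bullet> \<Phi> v = 0"
    then have "\<forall>j. c $ j = 0" by (intro real_indep) (simp add: \<Phi>_def inner_vec_def)
    then show "c = 0" by (simp add: vec_eq_iff)
  qed
  moreover have "Re (\<psi> j (L x)) = 0" for j x using tangent[of j x] by (simp add: \<phi>_\<psi>)
  ultimately have kernel: "\<exists>x. v = L x" if "\<forall>j. Re (\<psi> j v) = 0" for v
    using that assms(1,2) card
    by (intro range_eq_kernel_if_dim_eq[of L \<Phi>]) (auto simp: \<Phi>_def vec_eq_iff \<phi>_\<psi>)
  have "surj (\<lambda>v. ((\<chi> j. Re (\<psi> j v)), (\<chi> j. Im (\<psi> j v))))"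
    unfolding \<psi>_def by (rule surj_Re_Im_cdot[OF complex_indep])
  then obtain v where "(0, \<chi> j. - Re (\<psi> j w)) = ((\<chi> j. Re (\<psi> j v)), (\<chi> j. Im (\<psi> j v)))"
    unfolding surj_def by blast
  then have v: "\<forall>j. Re (\<psi> j v) = 0 \<and> Im (\<psi> j v) = - Re (\<psi> j w)"
    by (simp add: vec_eq_iff)
  obtain y where y: "v = L y" using kernel v by blast
  have "\<forall>j. Re (\<psi> j (w - \<i> *s v)) = 0" using v by (simp add: \<psi>_def cdot_diff cdot_smult)
  then obtain x where x: "w - \<i> *s v = L x" using kernel by blast
  show "\<exists>x y. w = L x + \<i> *s L y"
    by (intro exI[of _ x] exI[of _ y]) (simp add: x[symmetric] y[symmetric])
qed

section \<open>The splitting \<open>\<complex>\<^sup>N = \<complex>\<^sup>N\<^sup>1 \<times> \<complex>\<^sup>N\<^sup>2\<close>\<close>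

definition proj1 :: "complex^('a::finite + 'b::finite) \<Rightarrow> complex^'a" where
  "proj1 w = (\<chi> i. w $ Inl i)"

lemma proj1_emb [simp]: "proj1 (emb z :: complex^('a::finite + 'b::finite)) = z"
  by (simp add: proj1_def emb_def vec_eq_iff)

lemma emb_Inl [simp]: "(emb z :: complex^('a::finite + 'b::finite)) $ Inl i = z $ i"
  by (simp add: emb_def)

lemma emb_Inr [simp]: "(emb z :: complex^('a::finite + 'b::finite)) $ Inr j = 0"
  by (simp add: emb_def)

lemma emb_0 [simp]: "emb 0 = 0"
  by (simp add: emb_def vec_eq_iff split: sum.splits)

lemma emb_proj1: "(\<And>j. w $ Inr j = 0) \<Longrightarrow> emb (proj1 w) = w"
  by (auto simp: emb_def proj1_def vec_eq_iff split: sum.splits)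

lemma proj1_diff: "proj1 (u - v) = proj1 u - proj1 v"
  by (simp add: proj1_def vec_eq_iff)

lemma bounded_linear_proj1: "bounded_linear proj1"
  by (simp add: linear_conv_bounded_linear[symmetric] proj1_def linearI vec_eq_iff)

lemma bounded_linear_emb: "bounded_linear emb"
  by (auto simp: linear_conv_bounded_linear[symmetric] emb_def vec_eq_iff
      intro!: linearI split: sum.splits)

lemma norm_proj1_le: "norm (proj1 w) \<le> norm w"
proof -
  have "norm (proj1 w) ^ 2 = (\<Sum>s\<in>range Inl. norm (w $ s) ^ 2)"
    by (simp add: proj1_def norm_vec_def L2_set_def sum_nonneg sum.reindex)
  also have "\<dots> \<le> (\<Sum>s\<in>UNIV. norm (w $ s) ^ 2)"
    by (rule sum_mono2) auto
  also have "\<dots> = norm w ^ 2" by (simp add: norm_vec_def L2_set_def sum_nonneg)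
  finally show ?thesis by (rule power2_le_imp_le) simp
qed

lemma sum_UNIV_Plus:
  "(\<Sum>s\<in>(UNIV::('a::finite + 'b::finite) set). f s) = (\<Sum>i\<in>UNIV. f (Inl i)) + (\<Sum>j\<in>UNIV. f (Inr j))"
  using sum.Plus[of "UNIV::'a set" "UNIV::'b set" f]
  by (simp add: UNIV_Plus_UNIV[symmetric] comp_def del: UNIV_Plus_UNIV)

lemma prod_UNIV_Plus:
  "(\<Prod>s\<in>(UNIV::('a::finite + 'b::finite) set). f s) = (\<Prod>i\<in>UNIV. f (Inl i)) * (\<Prod>j\<in>UNIV. f (Inr j))"
  using prod.Plus[of "UNIV::'a set" "UNIV::'b set" f]
  by (simp add: UNIV_Plus_UNIV[symmetric] comp_def del: UNIV_Plus_UNIV)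

lemma sum_ext_mi [simp]: "sum (ext_mi \<beta> :: 'a::finite + 'b::finite \<Rightarrow> nat) UNIV = sum \<beta> UNIV"
  by (simp add: sum_UNIV_Plus ext_mi_def)

lemma sum_unit_mi: "sum (unit_mi j :: 'a::finite \<Rightarrow> nat) UNIV = 1"
  by (simp add: unit_mi_def)

lemma ext_mi_unit_mi: "ext_mi (unit_mi j) = unit_mi (Inl j)"
  by (auto simp: ext_mi_def unit_mi_def fun_eq_iff split: sum.splits)

lemma inj_ext_mi: "inj ext_mi"
  unfolding inj_def ext_mi_def fun_eq_iff by (metis sum.case(1))

lemma monom_emb_ext_mi: "monom (ext_mi \<beta> :: 'a::finite + 'b::finite \<Rightarrow> nat) (emb z) = monom \<beta> z"
  by (simp add: monom_def prod_UNIV_Plus ext_mi_def)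

lemma monom_emb_eq_0:
  assumes "\<alpha> \<notin> range ext_mi"
  shows "monom (\<alpha> :: 'a::finite + 'b::finite \<Rightarrow> nat) (emb z) = 0"
proof -
  have "\<exists>j. \<alpha> (Inr j) \<noteq> 0"
  proof (rule ccontr)
    assume "\<not> (\<exists>j. \<alpha> (Inr j) \<noteq> 0)"
    then have "\<alpha> = ext_mi (\<lambda>i. \<alpha> (Inl i))" by (auto simp: ext_mi_def fun_eq_iff split: sum.splits)
    with assms show False by blast
  qed
  then obtain j where "\<alpha> (Inr j) \<noteq> 0" by blast
  then show ?thesis unfolding monom_def by (intro prod_zero) (auto intro!: exI[of _ "Inr j"])
qed

lemma trunc_map_emb_component:
  fixes a :: "(('a::finite + 'b::finite) \<Rightarrow> nat) \<Rightarrow> complex^('a + 'b)"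
  shows "trunc_map a k (emb z) $ s = (\<Sum>\<beta>\<in>{\<beta>. sum \<beta> UNIV < k}. a (ext_mi \<beta>) $ s * monom \<beta> z)"
proof -
  have "trunc_map a k (emb z) $ s = (\<Sum>\<alpha>\<in>{\<alpha>. sum \<alpha> UNIV < k}. monom \<alpha> (emb z) * a \<alpha> $ s)"
    by (simp add: trunc_map_def sum_component)
  also have "\<dots> = (\<Sum>\<alpha>\<in>ext_mi ` {\<beta>. sum \<beta> UNIV < k}. monom \<alpha> (emb z) * a \<alpha> $ s)"
  proof (rule sum.mono_neutral_right[OF finite_multi_indices_less])
    show "\<forall>\<alpha>\<in>{\<alpha>. sum \<alpha> UNIV < k} - ext_mi ` {\<beta>. sum \<beta> UNIV < k}. monom \<alpha> (emb z) * a \<alpha> $ s = 0"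
      by (auto intro!: monom_emb_eq_0)
  qed auto
  also have "\<dots> = (\<Sum>\<beta>\<in>{\<beta>. sum \<beta> UNIV < k}. a (ext_mi \<beta>) $ s * monom \<beta> z)"
    by (simp add: sum.reindex inj_on_subset[OF inj_ext_mi] monom_emb_ext_mi mult.commute)
  finally show ?thesis .
qed

lemma trunc_map_restrict_first:
  fixes a :: "(('a::finite + 'b::finite) \<Rightarrow> nat) \<Rightarrow> complex^('a + 'b)"
  shows "trunc_map (\<lambda>\<beta>. \<chi> i. a (ext_mi \<beta>) $ Inl i) k z = proj1 (trunc_map a k (emb z))"
proof (subst vec_eq_iff, intro allI)
  fix i
  have "proj1 (trunc_map a k (emb z)) $ i = trunc_map a k (emb z) $ Inl i" by (simp add: proj1_def)
  also have "\<dots> = trunc_map (\<lambda>\<beta>. \<chi> i. a (ext_mi \<beta>) $ Inl i) k z $ i"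
    by (simp only: trunc_map_emb_component) (simp add: trunc_map_def sum_component mult.commute)
  finally show "trunc_map (\<lambda>\<beta>. \<chi> i. a (ext_mi \<beta>) $ Inl i) k z $ i = proj1 (trunc_map a k (emb z)) $ i"
    by simp
qed

lemma tendsto_trunc_map:
  fixes a :: "('m::finite \<Rightarrow> nat) \<Rightarrow> complex^'m"
  assumes "(f \<longlongrightarrow> v) F"
  shows "((\<lambda>x. trunc_map a k (f x)) \<longlongrightarrow> trunc_map a k v) F"
proof -
  have "trunc_map a k z = (\<chi> s. \<Sum>\<alpha>\<in>{\<alpha>. sum \<alpha> UNIV < k}. monom \<alpha> z * a \<alpha> $ s)" for z
    by (simp add: trunc_map_def vec_eq_iff sum_component)
  then show ?thesis using assms by (simp only:) (intro tendsto_intros tendsto_vec_lambda)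
qed

lemma trunc_map_0:
  fixes a :: "('m::finite \<Rightarrow> nat) \<Rightarrow> complex^'m"
  assumes "invertible_formal_map a"
  shows "trunc_map a k 0 = 0"
  unfolding trunc_map_def
proof (intro sum.neutral ballI)
  fix \<alpha> :: "'m \<Rightarrow> nat"
  show "monom \<alpha> 0 *s a \<alpha> = 0"
  proof (cases "\<alpha> = (\<lambda>_. 0)")
    case True
    then show ?thesis using assms by (simp add: invertible_formal_map_def)
  next
    case False
    then obtain i where "\<alpha> i \<noteq> 0" by auto
    then have "monom \<alpha> 0 = 0" unfolding monom_def by (intro prod_zero) (auto intro!: bexI[of _ i])
    then show ?thesis by simp
  qed
qed

text \<open>The Jacobian of \<open>H\<close> at \<open>0\<close> is block triangular once the \<open>Z\<^sup>1\<close>-derivatives of \<open>H\<^sup>2\<close> vanish,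
  so its upper left block, the Jacobian of \<open>H\<^sup>1(\<cdot>, 0)\<close>, is invertible.\<close>

lemma invertible_formal_map_restrict_first:
  fixes a :: "(('a::finite + 'b::finite) \<Rightarrow> nat) \<Rightarrow> complex^('a + 'b)"
  assumes "invertible_formal_map a" and normal: "\<And>i j. a (unit_mi (Inl i)) $ Inr j = 0"
  shows "invertible_formal_map (\<lambda>\<beta>. \<chi> i. a (ext_mi \<beta>) $ Inl i)"
proof -
  define J where "J = ((\<chi> i j. a (unit_mi j) $ i) :: complex^('a+'b)^('a+'b))"
  define A where "A = ((\<chi> i j. a (ext_mi (unit_mi j)) $ Inl i) :: complex^'a^'a)"
  have "inj ((*v) J)"
    using assms(1) det_nz_iff_inj_gen[OF matrix_vector_mul_linear_gen[of J]]
    by (simp add: J_def invertible_formal_map_def matrix_of_matrix_vector_mul)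
  have "inj ((*v) A)"
  proof (rule injI)
    fix x y :: "complex^'a" assume "A *v x = A *v y"
    then have Av: "A *v (x - y) = 0" by (simp add: matrix_vector_mult_diff_distrib)
    have "J *v emb (x - y) = J *v 0"
    proof (subst vec_eq_iff, intro allI)
      fix s :: "'a + 'b"
      show "(J *v emb (x - y)) $ s = (J *v 0) $ s"
        using Av normal
        by (cases s) (simp_all add: matrix_vector_mult_def J_def A_def sum_UNIV_Plus emb_def
            ext_mi_unit_mi vec_eq_iff)
    qed
    then have "(emb (x - y) :: complex^('a + 'b)) = 0" by (rule injD[OF \<open>inj ((*v) J)\<close>])
    then have "x - y = proj1 (0 :: complex^('a + 'b))" using proj1_emb[of "x - y", where 'b='b] by simp
    then show "x = y" by (simp add: proj1_def vec_eq_iff)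
  qed
  then have "det A \<noteq> 0"
    using det_nz_iff_inj_gen[OF matrix_vector_mul_linear_gen[of A]]
    by (simp add: matrix_of_matrix_vector_mul)
  moreover have "(ext_mi (\<lambda>_. 0) :: 'a + 'b \<Rightarrow> nat) = (\<lambda>_. 0)"
    by (auto simp: ext_mi_def fun_eq_iff split: sum.split)
  ultimately show ?thesis
    using assms(1) by (simp add: invertible_formal_map_def A_def vec_eq_iff)
qed

section \<open>Parametrizations and defining functions\<close>

lemma has_derivative_component_eq_0:
  fixes Z :: "'x::real_normed_vector \<Rightarrow> 'y::real_normed_vector^'n"
  assumes "(Z has_derivative D) (at x)" "open V" "x \<in> V" "\<And>y. y \<in> V \<Longrightarrow> Z y $ i = 0"
  shows "D v $ i = 0"
proof -
  have "((\<lambda>y. Z y $ i) has_derivative (\<lambda>v. D v $ i)) (at x)"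
    by (rule bounded_linear.has_derivative[OF bounded_linear_vec_nth assms(1)])
  moreover have "((\<lambda>y. Z y $ i) has_derivative (\<lambda>v. 0)) (at x)"
    by (rule has_derivative_transform_within_open[OF has_derivative_const assms(2,3)])
      (simp add: assms(4))
  ultimately have "(\<lambda>v. D v $ i) = (\<lambda>v. 0)" by (rule has_derivative_unique)
  then show ?thesis by metis
qed

lemma real_analytic_map_on_proj1:
  fixes Z :: "'x::euclidean_space \<Rightarrow> complex^('a::finite + 'b::finite)"
  assumes "real_analytic_map_on Z V"
  shows "real_analytic_map_on (\<lambda>x. proj1 (Z x)) V"
  unfolding real_analytic_map_on_def
proof
  fix b :: "complex^'a" assume "b \<in> Basis"
  then obtain i u where iu: "b = axis i u" "u \<in> Basis" by (auto simp: Basis_vec_def)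
  then have "axis (Inl i :: 'a + 'b) u \<in> Basis" by (auto simp: Basis_vec_def)
  then have "real_analytic_on (\<lambda>x. Z x \<bullet> axis (Inl i) u) V"
    using assms by (simp add: real_analytic_map_on_def)
  moreover have "(\<lambda>x. proj1 (Z x) \<bullet> b) = (\<lambda>x. Z x \<bullet> axis (Inl i) u)"
    by (simp add: iu inner_axis proj1_def)
  ultimately show "real_analytic_on (\<lambda>x. proj1 (Z x) \<bullet> b) V" by simp
qed

lemma parametrization_has_derivative:
  assumes "parametrization M Z"
  obtains L where "(Z has_derivative L) (at 0)" "inj L"
proof -
  obtain V where "0 \<in> V" "real_analytic_map_on Z V" "inj (frechet_derivative Z (at 0))"
    using assms unfolding parametrization_def by blast
  then obtain L where "strict_derivative_at Z L 0"
    using real_analytic_map_on_strict_derivative by blast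
  then have "(Z has_derivative L) (at 0)" by (rule strict_derivative_at_imp_has_derivative)
  then show thesis
    using that \<open>inj (frechet_derivative Z (at 0))\<close> frechet_derivative_at by metis
qed

lemma homeomorphism_proj1:
  assumes hom: "homeomorphism V (emb ` M \<inter> W) Z g"
  shows "homeomorphism V (M \<inter> emb -` W) (\<lambda>x. proj1 (Z x)) (g \<circ> emb)"
  unfolding homeomorphism_def
proof (intro conjI ballI)
  have image: "emb ` (M \<inter> emb -` W) = emb ` M \<inter> W" by auto
  have Z_emb: "Z x = emb (proj1 (Z x))" if "x \<in> V" for x
    using hom that unfolding homeomorphism_def by force
  show "(g \<circ> emb) (proj1 (Z x)) = x" if "x \<in> V" for x
    using hom that Z_emb[OF that, symmetric] by (simp add: homeomorphism_def)
  show "(\<lambda>x. proj1 (Z x)) ` V = M \<inter> emb -` W"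
  proof
    show "(\<lambda>x. proj1 (Z x)) ` V \<subseteq> M \<inter> emb -` W"
      using hom Z_emb by (force simp: homeomorphism_def)
    show "M \<inter> emb -` W \<subseteq> (\<lambda>x. proj1 (Z x)) ` V"
    proof
      fix z assume "z \<in> M \<inter> emb -` W"
      then have "emb z \<in> Z ` V" using hom by (auto simp: homeomorphism_def)
      then obtain x where "x \<in> V" "emb z = Z x" by blast
      then show "z \<in> (\<lambda>x. proj1 (Z x)) ` V" by (metis image_eqI proj1_emb)
    qed
  qed
  show "proj1 (Z ((g \<circ> emb) z)) = z" if "z \<in> M \<inter> emb -` W" for z
  proof -
    have "Z (g (emb z)) = emb z" using hom that by (auto simp: homeomorphism_def)
    then show ?thesis by simp
  qed
  have "(g \<circ> emb) ` (M \<inter> emb -` W) = g ` (emb ` M \<inter> W)"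
    by (simp only: image_comp[symmetric] image)
  then show "(g \<circ> emb) ` (M \<inter> emb -` W) = V"
    using hom by (simp add: homeomorphism_def)
  show "continuous_on V (\<lambda>x. proj1 (Z x))"
    using hom by (intro bounded_linear.continuous_on[OF bounded_linear_proj1])
      (simp add: homeomorphism_def)
  show "continuous_on (M \<inter> emb -` W) (g \<circ> emb)"
    using hom image
    by (intro continuous_on_compose linear_continuous_on[OF bounded_linear_emb])
      (simp add: homeomorphism_def)
qed

lemma inj_frechet_derivative_proj1:
  fixes Z :: "'x::euclidean_space \<Rightarrow> complex^('a::finite + 'b::finite)"
  assumes "real_analytic_map_on Z V" "open V" "x \<in> V" "inj (frechet_derivative Z (at x))"
    and "\<And>y j. y \<in> V \<Longrightarrow> Z y $ Inr j = 0"
  shows "inj (frechet_derivative (\<lambda>y. proj1 (Z y)) (at x))"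
proof -
  obtain D where D: "(Z has_derivative D) (at x)"
    using real_analytic_map_on_strict_derivative[OF assms(1,3)]
      strict_derivative_at_imp_has_derivative by blast
  then have "inj D" using assms(4) frechet_derivative_at by metis
  have "D v $ Inr j = 0" for v j
    using has_derivative_component_eq_0[OF D assms(2,3)] assms(5) by simp
  then have D_emb: "D v = emb (proj1 (D v))" for v by (simp add: emb_proj1)
  have "inj (\<lambda>v. proj1 (D v))"
  proof (rule injI)
    fix u v assume "proj1 (D u) = proj1 (D v)"
    then have "D u = D v" by (subst (1 2) D_emb) simp
    then show "u = v" by (rule injD[OF \<open>inj D\<close>])
  qed
  moreover have "((\<lambda>y. proj1 (Z y)) has_derivative (\<lambda>v. proj1 (D v))) (at x)"
    by (rule bounded_linear.has_derivative[OF bounded_linear_proj1 D])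
  ultimately show ?thesis by (simp add: frechet_derivative_at[symmetric])
qed

lemma parametrization_proj1:
  fixes Z :: "real^'p::finite \<Rightarrow> complex^('a::finite + 'b::finite)"
  assumes "parametrization (emb ` M) Z"
  shows "parametrization M (\<lambda>x. proj1 (Z x))" and "\<forall>\<^sub>F x in nhds 0. Z x = emb (proj1 (Z x))"
proof -
  obtain V W g where "Z 0 = 0" "open V" "0 \<in> V" "open W" "0 \<in> W"
    and analytic: "real_analytic_map_on Z V" and hom: "homeomorphism V (emb ` M \<inter> W) Z g"
    and inj_deriv: "\<forall>x\<in>V. inj (frechet_derivative Z (at x))"
    using assms unfolding parametrization_def by blast
  have Z_emb: "Z x = emb (proj1 (Z x))" if "x \<in> V" for x
    using hom that unfolding homeomorphism_def by force
  then show "\<forall>\<^sub>F x in nhds 0. Z x = emb (proj1 (Z x))"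
    using eventually_nhds_in_open[OF \<open>open V\<close> \<open>0 \<in> V\<close>] by (auto elim: eventually_mono)
  have "Z y $ Inr j = 0" if "y \<in> V" for y j by (subst Z_emb[OF that]) simp
  then have "\<forall>x\<in>V. inj (frechet_derivative (\<lambda>y. proj1 (Z y)) (at x))"
    using inj_deriv by (blast intro: inj_frechet_derivative_proj1[OF analytic \<open>open V\<close>])
  moreover have "open (emb -` W)" "0 \<in> emb -` W"
    using continuous_open_vimage[OF \<open>open W\<close>] linear_continuous_at[OF bounded_linear_emb] \<open>0 \<in> W\<close>
    by auto
  moreover have "proj1 (Z 0) = 0" using \<open>Z 0 = 0\<close> by (simp add: proj1_def vec_eq_iff)
  ultimately show "parametrization M (\<lambda>x. proj1 (Z x))"
    unfolding parametrization_def
    using \<open>open V\<close> \<open>0 \<in> V\<close> real_analytic_map_on_proj1[OF analytic] homeomorphism_proj1[OF hom]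
    by blast
qed

lemma defining_function_on_strict_derivative:
  assumes "defining_function_on M \<rho> U" "p \<in> M \<inter> U"
  obtains D where "strict_derivative_at \<rho> D p" "surj D"
    and "\<And>j. frechet_derivative (\<lambda>W. \<rho> W $ j) (at p) = (\<lambda>v. D v $ j)"
proof -
  obtain D where D: "strict_derivative_at \<rho> D p"
    using assms real_analytic_map_on_strict_derivative unfolding defining_function_on_def by blast
  have "((\<lambda>W. \<rho> W $ j) has_derivative (\<lambda>v. D v $ j)) (at p)" for j
    by (rule bounded_linear.has_derivative[OF bounded_linear_vec_nth
          strict_derivative_at_imp_has_derivative[OF D]])
  then have frechet: "frechet_derivative (\<lambda>W. \<rho> W $ j) (at p) = (\<lambda>v. D v $ j)" for j
    using frechet_derivative_at by metis
  have "surj D"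
  proof (rule surj_if_orthogonal_range_trivial)
    show "linear D" using D by (simp add: strict_derivative_at_def)
    fix c assume "\<forall>v. c \<bullet> D v = 0"
    then have "\<forall>j. c $ j = 0"
      using assms unfolding defining_function_on_def by (auto simp: frechet inner_vec_def)
    then show "c = 0" by (simp add: vec_eq_iff)
  qed
  then show thesis using that D frechet by blast
qed

lemma defining_function_on_tangent:
  assumes \<rho>: "defining_function_on M \<rho> U" and "parametrization M Z"
    and Z: "(Z has_derivative L) (at 0)" and D: "(\<rho> has_derivative D) (at 0)"
  shows "D (L x) = 0"
proof -
  obtain V W g where "Z 0 = 0" "open V" "0 \<in> V" and hom: "homeomorphism V (M \<inter> W) Z g"
    using assms(2) unfolding parametrization_def by blast
  have Z_M: "Z x \<in> M" if "x \<in> V" for x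
    using hom that unfolding homeomorphism_def by blast
  have "open U" "0 \<in> U" "M \<inter> U = {z\<in>U. \<rho> z = 0}" using \<rho> by (simp_all add: defining_function_on_def)
  then have \<rho>_zero: "\<rho> z = 0" if "z \<in> M \<inter> U" for z using that by blast
  have "(Z \<longlongrightarrow> 0) (at 0)"
    using has_derivative_continuous[OF Z] \<open>Z 0 = 0\<close> by (simp add: continuous_at)
  then have "\<forall>\<^sub>F x in at 0. Z x \<in> U \<and> x \<in> V"
    using \<open>open U\<close> \<open>0 \<in> U\<close> eventually_nhds_in_open[OF \<open>open V\<close> \<open>0 \<in> V\<close>]
    by (auto simp: tendsto_def eventually_nhds_conv_at intro: eventually_conj)
  then have "\<forall>\<^sub>F x in at 0. 0 = \<rho> (Z x)"
    using \<rho>_zero Z_M by (auto elim: eventually_mono)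
  moreover have "\<rho> (Z 0) = 0"
    using \<rho>_zero Z_M[OF \<open>0 \<in> V\<close>] \<open>Z 0 = 0\<close> \<open>0 \<in> U\<close> by simp
  ultimately have "((\<lambda>x. \<rho> (Z x)) has_derivative (\<lambda>_. 0)) (at 0)"
    by (intro has_derivative_transform_eventually[OF has_derivative_const]) auto
  moreover have "((\<lambda>x. \<rho> (Z x)) has_derivative (\<lambda>v. D (L v))) (at 0)"
    using diff_chain_at[OF Z, of \<rho> D] D \<open>Z 0 = 0\<close> by (simp add: comp_def)
  ultimately have "(\<lambda>_. 0) = (\<lambda>v. D (L v))" by (rule has_derivative_unique)
  then show ?thesis by (metis (no_types))
qed

lemma generic_submanifold_tangent_spans:
  fixes Z :: "real^'p::finite \<Rightarrow> complex^'a::finite"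
  assumes "generic_submanifold TYPE('d::finite) M" "parametrization M Z"
    and "CARD('p) + CARD('d) = 2 * CARD('a)" and Z: "(Z has_derivative L) (at 0)"
  shows "\<forall>w. \<exists>x y. w = L x + \<i> *s L y"
proof -
  obtain \<rho> :: "complex^'a \<Rightarrow> real^'d" and U where "0 \<in> M" and \<rho>: "defining_function_on M \<rho> U"
    and complex_indep: "\<forall>Z\<in>M \<inter> U. \<forall>c :: 'd \<Rightarrow> complex.
           (\<Sum>j\<in>UNIV. c j *s cgrad (\<lambda>W. \<rho> W $ j) Z) = 0 \<longrightarrow> (\<forall>j. c j = 0)"
    using assms(1) unfolding generic_submanifold_def by blast
  have "0 \<in> M \<inter> U" using \<rho> \<open>0 \<in> M\<close> by (auto simp: defining_function_on_def)
  obtain D where D: "strict_derivative_at \<rho> D 0"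
    and frechet: "\<And>j. frechet_derivative (\<lambda>W. \<rho> W $ j) (at 0) = (\<lambda>v. D v $ j)"
    by (rule defining_function_on_strict_derivative[OF \<rho> \<open>0 \<in> M \<inter> U\<close>]) blast
  have "inj (frechet_derivative Z (at 0))"
    using assms(2) unfolding parametrization_def by blast
  then have "inj L" using frechet_derivative_at[OF Z] by simp
  show ?thesis
  proof (rule generic_tangent_space_spans[OF _ \<open>inj L\<close> assms(3)])
    show "linear L" using has_derivative_bounded_linear[OF Z] by (simp add: bounded_linear.linear)
    show "linear (\<lambda>v. D v $ j)" for j
      using D unfolding strict_derivative_at_def linear_conv_bounded_linear
      by (blast intro: bounded_linear_compose[OF bounded_linear_vec_nth])
    have "\<forall>Z\<in>M \<inter> U. \<forall>c :: 'd \<Rightarrow> real.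
        (\<forall>v. (\<Sum>j\<in>UNIV. c j * frechet_derivative (\<lambda>W. \<rho> W $ j) (at Z) v) = 0) \<longrightarrow> (\<forall>j. c j = 0)"
      using \<rho> by (simp add: defining_function_on_def)
    then have "\<forall>c :: 'd \<Rightarrow> real.
        (\<forall>v. (\<Sum>j\<in>UNIV. c j * frechet_derivative (\<lambda>W. \<rho> W $ j) (at 0) v) = 0) \<longrightarrow> (\<forall>j. c j = 0)"
      using \<open>0 \<in> M \<inter> U\<close> by (rule bspec)
    then show "\<forall>j. c j = 0" if "\<forall>v. (\<Sum>j\<in>UNIV. c j * D v $ j) = 0" for c :: "'d \<Rightarrow> real"
      using that by (simp add: frechet)
    show "\<forall>j. c j = 0" if "(\<Sum>j\<in>UNIV. c j *s complex_gradient (\<lambda>v. D v $ j)) = 0" for c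
      using that complex_indep \<open>0 \<in> M \<inter> U\<close> by (simp add: cgrad_eq_complex_gradient frechet)
    show "D (L x) $ j = 0" for x j
      using defining_function_on_tangent[OF \<rho> assms(2) Z strict_derivative_at_imp_has_derivative[OF D]]
      by simp
  qed
qed

section \<open>Distance to a submanifold\<close>

text \<open>The nearby points of \<open>M\<close> may be required to lie in any neighbourhood of \<open>0\<close>, so that
  local defining functions of \<open>M\<close> vanish at them.\<close>

definition bigO_dist_pow :: "'b::real_normed_vector set \<Rightarrow> ('a::real_normed_vector \<Rightarrow> 'b) \<Rightarrow> nat \<Rightarrow> bool" where
  "bigO_dist_pow M f k \<longleftrightarrow>
     (\<forall>\<epsilon>>0. \<exists>C. \<forall>\<^sub>F x in nhds 0. \<exists>m\<in>M. norm m < \<epsilon> \<and> norm (f x - m) \<le> C * norm x ^ k)"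

lemma bigO_pow_eventually_cong:
  assumes "bigO_pow f k" "\<forall>\<^sub>F x in nhds 0. f x = g x"
  shows "bigO_pow g k"
proof -
  obtain C where "\<forall>\<^sub>F x in nhds 0. norm (f x) \<le> C * norm x ^ k"
    using assms(1) unfolding bigO_pow_def by blast
  then have "\<forall>\<^sub>F x in nhds 0. norm (g x) \<le> C * norm x ^ k"
    using assms(2) by eventually_elim simp
  then show ?thesis unfolding bigO_pow_def by blast
qed

lemma eventually_nhds_norm_less:
  assumes "continuous (at 0) f" "f 0 = 0" "0 < \<eta>"
  shows "\<forall>\<^sub>F x in nhds 0. norm (f x) < \<eta>"
proof -
  have "(f \<longlongrightarrow> 0) (at 0)" using assms(1,2) by (simp add: continuous_at)
  then have "\<forall>\<^sub>F x in at 0. dist (f x) 0 < \<eta>" using assms(3) by (rule tendstoD)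
  then show ?thesis using assms(2,3) by (simp add: eventually_nhds_conv_at)
qed

lemma local_defining_function_dist_le:
  fixes \<rho> :: "complex^'m::finite \<Rightarrow> real^'e::finite"
  assumes "local_defining_function M \<rho>" "0 \<in> M"
  shows "\<exists>C. \<forall>\<epsilon>>0. \<exists>\<eta>>0. \<forall>w. norm w < \<eta> \<longrightarrow>
           (\<exists>m\<in>M. norm m < \<epsilon> \<and> norm (w - m) \<le> C * norm (\<rho> w))"
proof -
  obtain U where \<rho>: "defining_function_on M \<rho> U"
    using assms(1) unfolding local_defining_function_def by blast
  then have "open U" "0 \<in> U" and zeros: "M \<inter> U = {z\<in>U. \<rho> z = 0}"
    by (simp_all add: defining_function_on_def)
  then have "\<rho> 0 = 0" "0 \<in> M \<inter> U" using assms(2) by blast+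
  obtain D where "strict_derivative_at \<rho> D 0" "surj D"
    by (rule defining_function_on_strict_derivative[OF \<rho> \<open>0 \<in> M \<inter> U\<close>]) blast
  from strict_derivative_surj_metric_regular[OF this \<open>\<rho> 0 = 0\<close>]
  obtain C where C: "\<forall>\<epsilon>>0. \<exists>\<eta>>0. \<forall>w. norm w < \<eta> \<longrightarrow>
      (\<exists>m. \<rho> m = 0 \<and> norm (m - w) \<le> C * norm (\<rho> w) \<and> norm m < \<epsilon>)"
    by blast
  have "\<exists>\<eta>>0. \<forall>w. norm w < \<eta> \<longrightarrow> (\<exists>m\<in>M. norm m < \<epsilon> \<and> norm (w - m) \<le> C * norm (\<rho> w))"
    if "0 < \<epsilon>" for \<epsilon>
  proof -
    obtain r where "0 < r" "ball 0 r \<subseteq> U" using open_contains_ball_eq \<open>open U\<close> \<open>0 \<in> U\<close> by blast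
    then have "0 < min \<epsilon> r" using \<open>0 < \<epsilon>\<close> by simp
    from C[rule_format, OF this] obtain \<eta> where "0 < \<eta>" and \<eta>: "\<forall>w. norm w < \<eta> \<longrightarrow>
        (\<exists>m. \<rho> m = 0 \<and> norm (m - w) \<le> C * norm (\<rho> w) \<and> norm m < min \<epsilon> r)"
      by blast
    have "\<exists>m\<in>M. norm m < \<epsilon> \<and> norm (w - m) \<le> C * norm (\<rho> w)" if w: "norm w < \<eta>" for w
    proof -
      obtain m where m: "\<rho> m = 0" "norm (m - w) \<le> C * norm (\<rho> w)" "norm m < min \<epsilon> r"
        using \<eta>[rule_format, OF w] by blast
      then have "m \<in> M" using \<open>ball 0 r \<subseteq> U\<close> zeros by auto
      with m show ?thesis by (auto simp: norm_minus_commute)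
    qed
    with \<open>0 < \<eta>\<close> show ?thesis by blast
  qed
  then show ?thesis by blast
qed

lemma bigO_dist_pow_if_defining_function:
  fixes f :: "'x::real_normed_vector \<Rightarrow> complex^'m::finite"
  assumes "local_defining_function M \<rho>" "0 \<in> M"
    and "continuous (at 0) f" "f 0 = 0" and "bigO_pow (\<lambda>x. \<rho> (f x)) k"
  shows "bigO_dist_pow M f k"
proof -
  obtain C where C: "\<forall>\<epsilon>>0. \<exists>\<eta>>0. \<forall>w. norm w < \<eta> \<longrightarrow>
      (\<exists>m\<in>M. norm m < \<epsilon> \<and> norm (w - m) \<le> C * norm (\<rho> w))"
    using local_defining_function_dist_le[OF assms(1,2)] by blast
  obtain Cb where Cb: "\<forall>\<^sub>F x in nhds 0. norm (\<rho> (f x)) \<le> Cb * norm x ^ k"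
    using assms(5) unfolding bigO_pow_def by blast
  have "\<forall>\<^sub>F x in nhds 0. \<exists>m\<in>M. norm m < \<epsilon> \<and> norm (f x - m) \<le> \<bar>C\<bar> * Cb * norm x ^ k"
    if "0 < \<epsilon>" for \<epsilon>
  proof -
    from C[rule_format, OF that] obtain \<eta> where "0 < \<eta>" and \<eta>: "\<forall>w. norm w < \<eta> \<longrightarrow>
        (\<exists>m\<in>M. norm m < \<epsilon> \<and> norm (w - m) \<le> C * norm (\<rho> w))"
      by blast
    show ?thesis
      using Cb eventually_nhds_norm_less[OF assms(3,4) \<open>0 < \<eta>\<close>]
    proof eventually_elim
      case (elim x)
      then obtain m where m: "m \<in> M" "norm m < \<epsilon>" "norm (f x - m) \<le> C * norm (\<rho> (f x))"
        using \<eta> by blast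
      note m(3)
      also have "C * norm (\<rho> (f x)) \<le> \<bar>C\<bar> * norm (\<rho> (f x))" by (simp add: mult_right_mono)
      also have "\<dots> \<le> \<bar>C\<bar> * (Cb * norm x ^ k)" using elim by (intro mult_left_mono) auto
      finally show ?case using m(1,2) by (auto simp: mult.assoc)
    qed
  qed
  then show ?thesis unfolding bigO_dist_pow_def by blast
qed

lemma bigO_pow_if_bigO_dist_pow:
  assumes \<rho>: "defining_function_on M \<rho> U"
    and "continuous (at 0) f" "f 0 = 0" and "bigO_dist_pow M f k"
  shows "bigO_pow (\<lambda>x. \<rho> (f x)) k"
proof -
  have "open U" "0 \<in> U" and zeros: "M \<inter> U = {z\<in>U. \<rho> z = 0}"
    using \<rho> by (simp_all add: defining_function_on_def)
  have "real_analytic_map_on \<rho> U" using \<rho> by (simp add: defining_function_on_def)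
  then obtain D where "strict_derivative_at \<rho> D 0"
    using real_analytic_map_on_strict_derivative \<open>0 \<in> U\<close> by blast
  then obtain \<delta> Lip where "0 < \<delta>" and Lip: "\<And>u v. norm (u - 0) \<le> \<delta> \<Longrightarrow> norm (v - 0) \<le> \<delta> \<Longrightarrow>
      norm (\<rho> u - \<rho> v) \<le> Lip * norm (u - v)"
    by (rule strict_derivative_at_lipschitz) blast
  obtain r where "0 < r" "ball 0 r \<subseteq> U" using open_contains_ball_eq \<open>open U\<close> \<open>0 \<in> U\<close> by blast
  then have "0 < min \<delta> r" using \<open>0 < \<delta>\<close> by simp
  then obtain C where C: "\<forall>\<^sub>F x in nhds 0. \<exists>m\<in>M. norm m < min \<delta> r \<and> norm (f x - m) \<le> C * norm x ^ k"
    using assms(4) unfolding bigO_dist_pow_def by blast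
  have "\<forall>\<^sub>F x in nhds 0. norm (\<rho> (f x)) \<le> \<bar>Lip\<bar> * C * norm x ^ k"
    using C eventually_nhds_norm_less[OF assms(2,3) \<open>0 < \<delta>\<close>]
  proof eventually_elim
    case (elim x)
    then obtain m where m: "m \<in> M" "norm m < min \<delta> r" "norm (f x - m) \<le> C * norm x ^ k" by blast
    then have "\<rho> m = 0" using \<open>ball 0 r \<subseteq> U\<close> zeros by auto
    then have "norm (\<rho> (f x)) \<le> Lip * norm (f x - m)" using Lip[of "f x" m] elim m by simp
    also have "\<dots> \<le> \<bar>Lip\<bar> * norm (f x - m)" by (simp add: mult_right_mono)
    also have "\<dots> \<le> \<bar>Lip\<bar> * (C * norm x ^ k)" using m(3) by (intro mult_left_mono) auto
    finally show ?case by (simp add: mult.assoc)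
  qed
  then show ?thesis unfolding bigO_pow_def by blast
qed

lemma bigO_dist_pow_proj1:
  fixes f :: "'x::real_normed_vector \<Rightarrow> complex^('a::finite + 'b::finite)"
  assumes "bigO_dist_pow (emb ` M) f k"
  shows "bigO_dist_pow M (\<lambda>x. proj1 (f x)) k"
  unfolding bigO_dist_pow_def
proof (intro allI impI)
  fix \<epsilon> :: real assume "0 < \<epsilon>"
  then obtain C where "\<forall>\<^sub>F x in nhds 0. \<exists>m\<in>emb ` M. norm m < \<epsilon> \<and> norm (f x - m) \<le> C * norm x ^ k"
    using assms unfolding bigO_dist_pow_def by blast
  then have "\<forall>\<^sub>F x in nhds 0. \<exists>m\<in>M. norm m < \<epsilon> \<and> norm (proj1 (f x) - m) \<le> C * norm x ^ k"
  proof eventually_elim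
    case (elim x)
    then obtain m where m: "m \<in> M" "norm (emb m :: complex^('a + 'b)) < \<epsilon>"
      "norm (f x - emb m) \<le> C * norm x ^ k" by blast
    moreover have "norm m \<le> norm (emb m :: complex^('a + 'b))"
      using norm_proj1_le[of "emb m :: complex^('a + 'b)"] by simp
    moreover have "norm (proj1 (f x) - m) \<le> norm (f x - emb m)"
      using norm_proj1_le[of "f x - emb m"] by (simp add: proj1_diff)
    ultimately show ?case by force
  qed
  then show "\<exists>C. \<forall>\<^sub>F x in nhds 0. \<exists>m\<in>M. norm m < \<epsilon> \<and> norm (proj1 (f x) - m) \<le> C * norm x ^ k" ..
qed

lemma bigO_pow_Inr_if_bigO_dist_pow_emb:
  fixes f :: "'x::real_normed_vector \<Rightarrow> complex^('a::finite + 'b::finite)"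
  assumes "bigO_dist_pow (emb ` M) f k"
  shows "bigO_pow (\<lambda>x. f x $ Inr j) k"
proof -
  obtain C where "\<forall>\<^sub>F x in nhds 0. \<exists>m\<in>emb ` M. norm m < 1 \<and> norm (f x - m) \<le> C * norm x ^ k"
    using assms zero_less_one unfolding bigO_dist_pow_def by blast
  then have "\<forall>\<^sub>F x in nhds 0. norm (f x $ Inr j) \<le> C * norm x ^ k"
  proof eventually_elim
    case (elim x)
    then obtain m where "norm (f x - emb m) \<le> C * norm x ^ k" by blast
    moreover have "norm ((f x - emb m) $ Inr j) \<le> norm (f x - emb m)"
      by (rule Finite_Cartesian_Product.norm_nth_le)
    ultimately show ?case by simp
  qed
  then show ?thesis unfolding bigO_pow_def by blast
qed

section \<open>Restricting a \<open>k\<close>-equivalence to the first factor\<close>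

lemma continuous_trunc_map_parametrization:
  assumes "parametrization M Z" "invertible_formal_map a"
  shows "continuous (at 0) (\<lambda>x. trunc_map a k (Z x))" "trunc_map a k (Z 0) = 0"
proof -
  obtain L where "(Z has_derivative L) (at 0)" by (rule parametrization_has_derivative[OF assms(1)])
  then have "isCont Z 0" by (rule has_derivative_continuous)
  then show "continuous (at 0) (\<lambda>x. trunc_map a k (Z x))"
    unfolding continuous_at by (intro tendsto_trunc_map) (simp add: continuous_at)
  show "trunc_map a k (Z 0) = 0"
    using assms trunc_map_0 by (simp add: parametrization_def)
qed

lemma k_equiv_bigO_dist_pow:
  fixes M M' :: "(complex^'m::finite) set"
  assumes "0 \<in> M'" "k_equiv TYPE('p::finite) TYPE('e::finite) M M' a k"
  obtains Z :: "real^'p \<Rightarrow> complex^'m" where "parametrization M Z" "invertible_formal_map a"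
    and "bigO_dist_pow M' (\<lambda>x. trunc_map a k (Z x)) k"
proof -
  obtain Z :: "real^'p \<Rightarrow> complex^'m" and \<rho>' :: "complex^'m \<Rightarrow> real^'e"
    where "invertible_formal_map a" "parametrization M Z" "local_defining_function M' \<rho>'"
      and "bigO_pow (\<lambda>x. \<rho>' (trunc_map a k (Z x))) k"
    using assms(2) unfolding k_equiv_def by blast
  moreover from this have "bigO_dist_pow M' (\<lambda>x. trunc_map a k (Z x)) k"
    using bigO_dist_pow_if_defining_function[OF _ assms(1)]
      continuous_trunc_map_parametrization by blast
  ultimately show thesis using that by blast
qed

lemma normal_coefficients_eq_0:
  fixes Z :: "real^'p::finite \<Rightarrow> complex^('a::finite + 'b::finite)"
  assumes "generic_submanifold TYPE('d::finite) M" "parametrization (emb ` M) Z"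
    and "CARD('p) + CARD('d) = 2 * CARD('a)"
    and near: "bigO_dist_pow (emb ` M') (\<lambda>x. trunc_map a k (Z x)) k" and "sum \<beta> UNIV < k"
  shows "a (ext_mi \<beta>) $ Inr j = 0"
proof -
  define Z1 where "Z1 x = proj1 (Z x)" for x
  have par1: "parametrization M Z1" and Z_emb: "\<forall>\<^sub>F x in nhds 0. Z x = emb (Z1 x)"
    using parametrization_proj1[OF assms(2)] by (simp_all add: Z1_def[abs_def])
  obtain L1 where L1: "(Z1 has_derivative L1) (at 0)" by (rule parametrization_has_derivative[OF par1])
  have "Z1 0 = 0" using par1 by (simp add: parametrization_def)
  show ?thesis
  proof (rule polynomial_bigO_coeffs_eq_0[OF L1 \<open>Z1 0 = 0\<close> _ _ assms(5)])
    show "\<forall>u. \<exists>x y. u = L1 x + \<i> *s L1 y"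
      by (rule generic_submanifold_tangent_spans[OF assms(1) par1 assms(3) L1])
    show "bigO_pow (\<lambda>x. \<Sum>\<beta>\<in>{\<beta>. sum \<beta> UNIV < k}. a (ext_mi \<beta>) $ Inr j * monom \<beta> (Z1 x)) k"
    proof (rule bigO_pow_eventually_cong)
      show "bigO_pow (\<lambda>x. trunc_map a k (Z x) $ Inr j) k"
        by (rule bigO_pow_Inr_if_bigO_dist_pow_emb[OF near])
      show "\<forall>\<^sub>F x in nhds 0. trunc_map a k (Z x) $ Inr j
          = (\<Sum>\<beta>\<in>{\<beta>. sum \<beta> UNIV < k}. a (ext_mi \<beta>) $ Inr j * monom \<beta> (Z1 x))"
        using Z_emb by eventually_elim (simp add: trunc_map_emb_component)
    qed
  qed
qed

lemma k_equiv_restrict_first: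
  fixes Z :: "real^'p::finite \<Rightarrow> complex^('a::finite + 'b::finite)"
  assumes "generic_submanifold TYPE('d::finite) M'" "parametrization (emb ` M) Z"
    and "invertible_formal_map a" "\<And>i j. a (unit_mi (Inl i)) $ Inr j = 0"
    and near: "bigO_dist_pow (emb ` M') (\<lambda>x. trunc_map a k (Z x)) k"
  shows "k_equiv TYPE('p) TYPE('d) M M' (\<lambda>\<beta>. \<chi> i. a (ext_mi \<beta>) $ Inl i) k"
proof -
  define Z1 where "Z1 x = proj1 (Z x)" for x
  have par1: "parametrization M Z1" and Z_emb: "\<forall>\<^sub>F x in nhds 0. Z x = emb (Z1 x)"
    using parametrization_proj1[OF assms(2)] by (simp_all add: Z1_def[abs_def])
  obtain \<rho> :: "complex^'a \<Rightarrow> real^'d" and U where \<rho>: "defining_function_on M' \<rho> U"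
    using assms(1) unfolding generic_submanifold_def by blast
  have "bigO_pow (\<lambda>x. \<rho> (trunc_map (\<lambda>\<beta>. \<chi> i. a (ext_mi \<beta>) $ Inl i) k (Z1 x))) k"
  proof (rule bigO_pow_eventually_cong)
    show "bigO_pow (\<lambda>x. \<rho> (proj1 (trunc_map a k (Z x)))) k"
      using continuous_trunc_map_parametrization[OF assms(2,3)]
      by (intro bigO_pow_if_bigO_dist_pow[OF \<rho> _ _ bigO_dist_pow_proj1[OF near]]
          bounded_linear.continuous[OF bounded_linear_proj1]) (simp_all add: proj1_def vec_eq_iff)
    show "\<forall>\<^sub>F x in nhds 0. \<rho> (proj1 (trunc_map a k (Z x)))
        = \<rho> (trunc_map (\<lambda>\<beta>. \<chi> i. a (ext_mi \<beta>) $ Inl i) k (Z1 x))"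
      using Z_emb by eventually_elim (simp add: trunc_map_restrict_first)
  qed
  then show ?thesis
    using invertible_formal_map_restrict_first[OF assms(3,4)] par1 \<rho>
    unfolding k_equiv_def local_defining_function_def by blast
qed

theorem lemma4p4:
  fixes M1 M1' :: "(complex^'a::finite) set"
    and a :: "(('a + 'b::finite) \<Rightarrow> nat) \<Rightarrow> complex^('a + 'b)"
    and k :: nat
  assumes "generic_submanifold TYPE('d::finite) M1"
    and "generic_submanifold TYPE('d) M1'"
    and "CARD('p::finite) + CARD('d) = 2 * CARD('a)"
    and "CARD('e::finite) = CARD('d) + 2 * CARD('b)"
    and "1 < k"
    and "k_equiv TYPE('p) TYPE('e) (emb ` M1) (emb ` M1') a k"
  shows "(\<forall>\<beta> j. sum \<beta> UNIV < k \<longrightarrow> a (ext_mi \<beta>) $ Inr j = 0)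
       \<and> k_equiv TYPE('p) TYPE('d) M1 M1' (\<lambda>\<beta>. \<chi> i. a (ext_mi \<beta>) $ Inl i) k"
proof -
  have "0 \<in> emb ` M1'" using assms(2) by (force simp: generic_submanifold_def)
  then obtain Z :: "real^'p \<Rightarrow> complex^('a + 'b)" where par: "parametrization (emb ` M1) Z"
    and inv: "invertible_formal_map a" and near: "bigO_dist_pow (emb ` M1') (\<lambda>x. trunc_map a k (Z x)) k"
    by (rule k_equiv_bigO_dist_pow[OF _ assms(6)]) blast
  have normal: "\<forall>\<beta> j. sum \<beta> UNIV < k \<longrightarrow> a (ext_mi \<beta>) $ Inr j = 0"
    using normal_coefficients_eq_0[OF assms(1) par assms(3) near] by blast
  then have "a (unit_mi (Inl i)) $ Inr j = 0" for i j
    using normal[rule_format, of "unit_mi i" j] assms(5) by (simp add: ext_mi_unit_mi sum_unit_mi)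
  with normal show ?thesis using k_equiv_restrict_first[OF assms(2) par inv _ near] by blast
qed

end
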